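(* Let $n\ge 1$ and let $k=(k_1,\dots,k_n)$ be a family of even positive integers. Let $B_k=\{(m_1,\dots,m_n)\in\mathbb Z^n: 1\le m_j\le k_j-1 \text{ for all } 1\le j\le n\}$. The $\mathbb C$-linear map $$\bigotimes_{j=1}^nS_{k_j}(SL_2(\mathbb Z))\to\mathbb C^{\mathfrak S_n}\otimes\mathbb C^{B_k},\qquad f_1\otimes\dots\otimes f_n\mapsto\Big(\Lambda^\sigma(f_1,\dots,f_n;m_1,\dots,m_n)\Big)_{\sigma\in\mathfrak S_n,\ (m_1,\dots,m_n)\in B_k}$$ is injective.
   Context: $S_k(SL_2(\mathbb Z))$ is the space of holomorphic cusp forms of weight $k$ and level $1$, and $\mathfrak S_n$ is the symmetric group. For $f_j\in S_{k_j}(SL_2(\mathbb Z))$, $$\Lambda(f_1,\dots,f_n;s_1,\dots,s_n)=\int_{0<t_1<\dots<t_n}f_1(it_1)t_1^{s_1-1}\cdots f_n(it_n)t_n^{s_n-1}\,dt_1\cdots dt_n,$$ extended holomorphically to $(s_1,\dots,s_n)\in\mathbb C^n$, and for $\sigma\in\mathfrak S_n$ $$\Lambda^\sigma(f_1,\dots,f_n;s_1,\dots,s_n)=\Lambda(f_{\sigma(1)},\dots,f_{\sigma(n)};s_{\sigma(1)},\dots,s_{\sigma(n)}).$$ *)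

theory Defs
  imports
    "HOL-Analysis.Analysis"
    "HOL-Library.Poly_Mapping"
    "HOL-Combinatorics.Permutations"
begin

section \<open>Cusp forms of level one\<close>

definition upper_half_plane :: "complex set" where
  "upper_half_plane = {z. 0 < Im z}"

text \<open>
  Elements of $S_k(SL_2(\mathbb{Z}))$ are functions on the upper half plane. They are represented
  by total functions that vanish off the upper half plane, so that equality of functions
  is equality of cusp forms. The last clause is the \<open>q\<close>-expansion, with
  \<open>q = exp (2\<pi>iz)\<close> and \<open>a r\<close> the coefficient of \<open>q ^ (r + 1)\<close>.
\<close>

definition cusp_forms :: "nat \<Rightarrow> (complex \<Rightarrow> complex) set" where
  "cusp_forms k = {f.
     f holomorphic_on upper_half_plane \<and>
     (\<forall>z. z \<notin> upper_half_plane \<longrightarrow> f z = 0) \<and>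
     (\<forall>a b c d :: int. a * d - b * c = 1 \<longrightarrow>
        (\<forall>z\<in>upper_half_plane.
           f ((of_int a * z + of_int b) / (of_int c * z + of_int d)) =
             (of_int c * z + of_int d) ^ k * f z)) \<and>
     (\<exists>a :: nat \<Rightarrow> complex. \<forall>z\<in>upper_half_plane.
        (\<lambda>r. a r * exp (2 * of_real pi * \<i> * z) ^ (r + 1)) sums f z)}"


section \<open>Multiple L-values\<close>

text \<open>
  Families indexed by \<open>1, \<dots>, n\<close> are functions on \<open>nat\<close>. On the domain of integration
  \<open>strict_mono_on {1..n} t\<close> says \<open>t 1 < \<dots> < t n\<close>. Cusp forms of level one decay
  exponentially along \<open>i t\<close> both for \<open>t \<rightarrow> \<infinity>\<close> and for \<open>t \<rightarrow> 0\<close>, so for them the integral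
  converges absolutely for every \<open>s\<close> and is itself the entire function of \<open>s\<close>; there is no
  further continuation to perform.
\<close>

definition mult_Lambda ::
  "nat \<Rightarrow> (nat \<Rightarrow> complex \<Rightarrow> complex) \<Rightarrow> (nat \<Rightarrow> complex) \<Rightarrow> complex" where
  "mult_Lambda n f s =
     (LINT t : {t. (\<forall>j\<in>{1..n}. 0 < t j) \<and> strict_mono_on {1..n} t} | PiM {1..n} (\<lambda>_. lborel).
        (\<Prod>j=1..n. f j (\<i> * complex_of_real (t j)) * complex_of_real (t j) powr (s j - 1)))"

definition mult_Lambda_perm ::
  "nat \<Rightarrow> (nat \<Rightarrow> nat) \<Rightarrow> (nat \<Rightarrow> complex \<Rightarrow> complex) \<Rightarrow> (nat \<Rightarrow> complex) \<Rightarrow> complex" where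
  "mult_Lambda_perm n \<sigma> f s = mult_Lambda n (f \<circ> \<sigma>) (s \<circ> \<sigma>)"


section \<open>Tensor products of spaces of complex-valued functions\<close>

text \<open>
  The tensor product of a family \<open>V j\<close>, \<open>j \<in> I\<close>, of complex vector spaces, in the usual
  construction: the free vector space on \<open>\<Pi>\<^sub>E j\<in>I. V j\<close> modulo the span of the multilinearity
  relations. Its elements are the cosets of that span. The vector spaces \<open>V j\<close> are spaces of
  complex-valued functions with pointwise operations.
\<close>

definition free_scale :: "complex \<Rightarrow> ('b \<Rightarrow>\<^sub>0 complex) \<Rightarrow> ('b \<Rightarrow>\<^sub>0 complex)" where
  "free_scale c x = Poly_Mapping.map ((*) c) x"

lemma lookup_free_scale [simp]:
  "Poly_Mapping.lookup (free_scale c x) b = c * Poly_Mapping.lookup x b"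
  by (simp add: free_scale_def Poly_Mapping.map.rep_eq when_def)

interpretation free: vector_space free_scale
  by standard (auto intro!: poly_mapping_eqI simp: lookup_add algebra_simps)

context
  fixes I :: "'i set" and V :: "'i \<Rightarrow> ('a \<Rightarrow> complex) set"
begin

definition free_space :: "(('i \<Rightarrow> 'a \<Rightarrow> complex) \<Rightarrow>\<^sub>0 complex) set" where
  "free_space = {x. Poly_Mapping.keys x \<subseteq> PiE I V}"

definition tensor_relations :: "(('i \<Rightarrow> 'a \<Rightarrow> complex) \<Rightarrow>\<^sub>0 complex) set" where
  "tensor_relations = free.span
     ({Poly_Mapping.single (f(j := (\<lambda>z. u z + v z))) 1
         - Poly_Mapping.single (f(j := u)) 1 - Poly_Mapping.single (f(j := v)) 1
       | f j u v. f \<in> PiE I V \<and> j \<in> I \<and> u \<in> V j \<and> v \<in> V j}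
      \<union> {Poly_Mapping.single (f(j := (\<lambda>z. c * u z))) 1
         - free_scale c (Poly_Mapping.single (f(j := u)) 1)
       | f j c u. f \<in> PiE I V \<and> j \<in> I \<and> u \<in> V j})"

definition tensor_class ::
  "(('i \<Rightarrow> 'a \<Rightarrow> complex) \<Rightarrow>\<^sub>0 complex) \<Rightarrow> (('i \<Rightarrow> 'a \<Rightarrow> complex) \<Rightarrow>\<^sub>0 complex) set" where
  "tensor_class x = {y \<in> free_space. y - x \<in> tensor_relations}"

definition tensor_product :: "(('i \<Rightarrow> 'a \<Rightarrow> complex) \<Rightarrow>\<^sub>0 complex) set set" where
  "tensor_product = tensor_class ` free_space"

definition pure_tensor ::
  "('i \<Rightarrow> 'a \<Rightarrow> complex) \<Rightarrow> (('i \<Rightarrow> 'a \<Rightarrow> complex) \<Rightarrow>\<^sub>0 complex) set" where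
  "pure_tensor f = tensor_class (Poly_Mapping.single f 1)"

definition tensor_add ::
  "(('i \<Rightarrow> 'a \<Rightarrow> complex) \<Rightarrow>\<^sub>0 complex) set \<Rightarrow> (('i \<Rightarrow> 'a \<Rightarrow> complex) \<Rightarrow>\<^sub>0 complex) set \<Rightarrow>
     (('i \<Rightarrow> 'a \<Rightarrow> complex) \<Rightarrow>\<^sub>0 complex) set" where
  "tensor_add X Y = (\<Union>x\<in>X. \<Union>y\<in>Y. tensor_class (x + y))"

definition tensor_scale ::
  "complex \<Rightarrow> (('i \<Rightarrow> 'a \<Rightarrow> complex) \<Rightarrow>\<^sub>0 complex) set \<Rightarrow>
     (('i \<Rightarrow> 'a \<Rightarrow> complex) \<Rightarrow>\<^sub>0 complex) set" where
  "tensor_scale c X = (\<Union>x\<in>X. tensor_class (free_scale c x))"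

definition tensor_linear ::
  "((('i \<Rightarrow> 'a \<Rightarrow> complex) \<Rightarrow>\<^sub>0 complex) set \<Rightarrow> 'p \<Rightarrow> complex) \<Rightarrow> bool" where
  "tensor_linear L \<longleftrightarrow>
     (\<forall>X\<in>tensor_product. \<forall>Y\<in>tensor_product. \<forall>p. L (tensor_add X Y) p = L X p + L Y p) \<and>
     (\<forall>c. \<forall>X\<in>tensor_product. \<forall>p. L (tensor_scale c X) p = c * L X p)"

lemma tensor_class_cong:
  assumes "y - x \<in> tensor_relations"
  shows "tensor_class y = tensor_class x"
proof -
  have "z - y \<in> tensor_relations \<longleftrightarrow> z - x \<in> tensor_relations" for z
  proof
    assume "z - y \<in> tensor_relations"
    then have "(z - y) + (y - x) \<in> tensor_relations"
      using assms unfolding tensor_relations_def by (rule free.span_add)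
    then show "z - x \<in> tensor_relations" by simp
  next
    assume "z - x \<in> tensor_relations"
    then have "(z - x) - (y - x) \<in> tensor_relations"
      using assms unfolding tensor_relations_def by (rule free.span_diff)
    then show "z - y \<in> tensor_relations" by simp
  qed
  then show ?thesis by (simp add: tensor_class_def)
qed

lemma mem_tensor_class_self: "x \<in> free_space \<Longrightarrow> x \<in> tensor_class x"
  by (simp add: tensor_class_def tensor_relations_def free.span_zero)

lemma tensor_class_eq_iff:
  assumes "x \<in> free_space" "y \<in> free_space"
  shows "tensor_class x = tensor_class y \<longleftrightarrow> x - y \<in> tensor_relations"
  using assms tensor_class_cong mem_tensor_class_self
  by (force simp: tensor_class_def)

lemma tensor_add_class:
  assumes "x \<in> free_space" "y \<in> free_space"
  shows "tensor_add (tensor_class x) (tensor_class y) = tensor_class (x + y)"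
proof -
  have "tensor_class (x' + y') = tensor_class (x + y)"
    if "x' \<in> tensor_class x" "y' \<in> tensor_class y" for x' y'
  proof (rule tensor_class_cong)
    have "(x' - x) + (y' - y) \<in> tensor_relations"
      using that unfolding tensor_class_def tensor_relations_def by (blast intro: free.span_add)
    then show "x' + y' - (x + y) \<in> tensor_relations" by (simp add: algebra_simps)
  qed
  then show ?thesis
    using assms mem_tensor_class_self unfolding tensor_add_def by blast
qed

lemma tensor_scale_class:
  assumes "x \<in> free_space"
  shows "tensor_scale c (tensor_class x) = tensor_class (free_scale c x)"
proof -
  have "tensor_class (free_scale c x') = tensor_class (free_scale c x)"
    if "x' \<in> tensor_class x" for x'
  proof (rule tensor_class_cong)
    have "free_scale c (x' - x) \<in> tensor_relations"
      using that unfolding tensor_class_def tensor_relations_def by (blast intro: free.span_scale)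
    then show "free_scale c x' - free_scale c x \<in> tensor_relations"
      by (simp add: free.scale_right_diff_distrib)
  qed
  then show ?thesis
    using assms mem_tensor_class_self unfolding tensor_scale_def by blast
qed

end


section \<open>The period map\<close>

definition period_index :: "nat \<Rightarrow> (nat \<Rightarrow> nat) \<Rightarrow> ((nat \<Rightarrow> nat) \<times> (nat \<Rightarrow> int)) set" where
  "period_index n k = {\<sigma>. \<sigma> permutes {1..n}} \<times> (\<Pi>\<^sub>E j\<in>{1..n}. {1..int (k j) - 1})"

abbreviation cusp_tensor ::
  "nat \<Rightarrow> (nat \<Rightarrow> nat) \<Rightarrow> ((nat \<Rightarrow> complex \<Rightarrow> complex) \<Rightarrow>\<^sub>0 complex) set set" where
  "cusp_tensor n k \<equiv> tensor_product {1..n} (\<lambda>j. cusp_forms (k j))"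

text \<open>
  The target is the space of families of complex numbers indexed by \<open>period_index n k\<close>, i.e.
  $\mathbb{C}^{\mathfrak{S}_n} \otimes \mathbb{C}^{B_k} = \mathbb{C}^{\mathfrak{S}_n \times B_k}$;
  families are extended by zero to all pairs.
\<close>

definition is_period_map ::
  "nat \<Rightarrow> (nat \<Rightarrow> nat) \<Rightarrow>
     (((nat \<Rightarrow> complex \<Rightarrow> complex) \<Rightarrow>\<^sub>0 complex) set \<Rightarrow> (nat \<Rightarrow> nat) \<times> (nat \<Rightarrow> int) \<Rightarrow> complex) \<Rightarrow> bool"
where
  "is_period_map n k L \<longleftrightarrow>
     tensor_linear {1..n} (\<lambda>j. cusp_forms (k j)) L \<and>
     (\<forall>X\<in>cusp_tensor n k. \<forall>p. p \<notin> period_index n k \<longrightarrow> L X p = 0) \<and>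
     (\<forall>f \<in> (\<Pi>\<^sub>E j\<in>{1..n}. cusp_forms (k j)). \<forall>(\<sigma>, m) \<in> period_index n k.
        L (pure_tensor {1..n} (\<lambda>j. cusp_forms (k j)) f) (\<sigma>, m) =
          mult_Lambda_perm n \<sigma> f (\<lambda>j. of_int (m j)))"

end

theory Submission
  imports Defs "HOL-Complex_Analysis.Complex_Analysis" "HOL-Probability.Distributions"
begin

text \<open>
  For fixed \<open>m\<close>, the domains \<open>t \<sigma>(1) < \<dots> < t \<sigma>(n)\<close> cover the positive orthant up to a null set, so
  the sum over \<open>\<sigma>\<close> of the multiple L-values is the product of the periods
  $\int_0^\infty f_j(it) t^{m_j - 1} dt$. It therefore suffices that the periods with
  \<open>1 \<le> m \<le> k - 1\<close> separate the cusp forms of weight \<open>k\<close>: a tensor product of injective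
  linear maps is injective.

  Let all periods of \<open>f\<close> vanish and let $F(iy) = \int_y^\infty f(it) (t - y)^{k - 2} dt$, which is, up to
  a constant, the \<open>q\<close>-series $\sum a_r r^{1 - k} q^r$. The substitution \<open>t \<mapsto> 1 / t\<close> and the
  vanishing of $\int_0^\infty f(it) (t - y)^{k - 2} dt$ give the transformation law of weight \<open>2 - k\<close>
  under \<open>z \<mapsto> - 1 / z\<close>, first on the imaginary axis and then everywhere. A cusp form of
  weight \<open>2 - k \<le> 0\<close> is zero by the maximum principle, so \<open>f = 0\<close>.
\<close>

section \<open>Tensor products and separating functionals\<close>

text \<open>Finite dimensionality of the spaces of cusp forms is never quoted: the periods are
  finitely many functionals, and their joint injectivity already expands every form in a finite
  family with periods as coefficients. This makes the quotient tractable: modulo the relations, an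
  element of the free space becomes a combination of finitely many fixed tensors, whose coefficients
  are exactly the values of products of periods on it. For an arbitrary cusp form, the two sides of
  the transformation law for F differ by a polynomial of degree at most k - 2 whose coefficients
  come from the periods, the period polynomial. The periods with 1 \<le> m \<le> k - 1 are therefore
  precisely the obstruction to modularity of F. The sign of the weight matters because the invariant
  function is \<open>norm (F z) / Im z ^ v\<close> with v = (k - 2) / 2: a bound for it is carried
  from height 1/2 to height 1/4 and compared there, and v \<ge> 0 makes the change of height
  harmless.\<close>

definition function_space :: "('a \<Rightarrow> complex) set \<Rightarrow> bool" where
  "function_space V \<longleftrightarrow> (\<lambda>_. 0) \<in> V \<and> (\<forall>u\<in>V. \<forall>v\<in>V. (\<lambda>z. u z + v z) \<in> V) \<and>
     (\<forall>c. \<forall>u\<in>V. (\<lambda>z. c * u z) \<in> V)"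

definition linear_functional :: "('a \<Rightarrow> complex) set \<Rightarrow> (('a \<Rightarrow> complex) \<Rightarrow> complex) \<Rightarrow> bool" where
  "linear_functional V l \<longleftrightarrow> (\<forall>u\<in>V. \<forall>v\<in>V. l (\<lambda>z. u z + v z) = l u + l v) \<and>
     (\<forall>c. \<forall>u\<in>V. l (\<lambda>z. c * u z) = c * l u)"

lemma function_space_zero: "function_space V \<Longrightarrow> (\<lambda>_. 0) \<in> V"
  and function_space_add: "function_space V \<Longrightarrow> u \<in> V \<Longrightarrow> v \<in> V \<Longrightarrow> (\<lambda>z. u z + v z) \<in> V"
  and function_space_scale: "function_space V \<Longrightarrow> u \<in> V \<Longrightarrow> (\<lambda>z. c * u z) \<in> V"
  by (auto simp: function_space_def)

lemma linear_functional_add: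
    "linear_functional V l \<Longrightarrow> u \<in> V \<Longrightarrow> v \<in> V \<Longrightarrow> l (\<lambda>z. u z + v z) = l u + l v"
  and linear_functional_scale: "linear_functional V l \<Longrightarrow> u \<in> V \<Longrightarrow> l (\<lambda>z. c * u z) = c * l u"
  by (auto simp: linear_functional_def)

lemma function_space_sum:
  assumes "function_space V" "finite M" "\<And>m. m \<in> M \<Longrightarrow> u m \<in> V"
  shows "(\<lambda>z. \<Sum>m\<in>M. c m * u m z) \<in> V"
  using assms(2,3)
proof (induction M rule: finite_induct)
  case empty
  then show ?case using function_space_zero[OF assms(1)] by simp
next
  case (insert m M)
  then show ?case
    using function_space_add[OF assms(1) function_space_scale[OF assms(1), of "u m" "c m"]] by simp
qed

text \<open>Induction on the functionals: on the kernel of \<open>l k\<close> the remaining ones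
  still separate. The vectors e need be neither a basis nor biorthogonal to l, so dependent
  functionals are allowed and no dimension has to be known.\<close>

lemma separating_functionals_dual_system:
  fixes V :: "('a \<Rightarrow> complex) set" and l :: "'m \<Rightarrow> ('a \<Rightarrow> complex) \<Rightarrow> complex"
  assumes "finite M" "function_space V" "\<And>m. m \<in> M \<Longrightarrow> linear_functional V (l m)"
    and "\<And>u. u \<in> V \<Longrightarrow> (\<And>m. m \<in> M \<Longrightarrow> l m u = 0) \<Longrightarrow> u = (\<lambda>_. 0)"
  shows "\<exists>e. (\<forall>m\<in>M. e m \<in> V) \<and> (\<forall>u\<in>V. u = (\<lambda>z. \<Sum>m\<in>M. l m u * e m z))"
  using assms
proof (induction M arbitrary: V rule: finite_induct)
  case empty
  then show ?case by fastforce
next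
  case (insert k M)
  note V = insert.prems(1)
  have lk: "linear_functional V (l k)" and lM: "\<And>m. m \<in> M \<Longrightarrow> linear_functional V (l m)"
    using insert.prems(2) by auto
  define V0 where "V0 = {u \<in> V. l k u = 0}"
  have l0: "l k (\<lambda>_. 0) = 0"
    using linear_functional_scale[OF lk function_space_zero[OF V], of 0] by simp
  have V0: "function_space V0"
    using l0 V lk by (auto simp: function_space_def V0_def linear_functional_def)
  have "\<exists>e. (\<forall>m\<in>M. e m \<in> V0) \<and> (\<forall>u\<in>V0. u = (\<lambda>z. \<Sum>m\<in>M. l m u * e m z))"
  proof (rule insert.IH[OF V0])
    show "linear_functional V0 (l m)" if "m \<in> M" for m
      using lM[OF that] by (auto simp: linear_functional_def V0_def)
    show "u = (\<lambda>_. 0)" if "u \<in> V0" "\<And>m. m \<in> M \<Longrightarrow> l m u = 0" for u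
      using that by (intro insert.prems(3)) (auto simp: V0_def)
  qed
  then obtain e where e: "\<And>m. m \<in> M \<Longrightarrow> e m \<in> V0"
    and ex: "\<And>u. u \<in> V0 \<Longrightarrow> u = (\<lambda>z. \<Sum>m\<in>M. l m u * e m z)" by blast
  show ?case
  proof (cases "\<forall>u\<in>V. l k u = 0")
    case True
    then have "V0 = V" by (auto simp: V0_def)
    \<comment> \<open>\<open>l k\<close> vanishes on V, so its vector is always multiplied by 0 and
      any choice in V would do.\<close>
    define e' where "e' = e(k := (\<lambda>_. 0))"
    have *: "(\<lambda>z. \<Sum>m\<in>M. l m u * e' m z) = (\<lambda>z. \<Sum>m\<in>M. l m u * e m z)" for u
      using insert.hyps by (intro ext sum.cong) (auto simp: e'_def)
    have "e' k = (\<lambda>_. 0)" by (simp add: e'_def)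
    moreover have "\<forall>m\<in>M. e' m \<in> V" using e \<open>V0 = V\<close> insert.hyps by (auto simp: e'_def)
    ultimately show ?thesis
      using ex \<open>V0 = V\<close> insert.hyps function_space_zero[OF V] *
      by (intro exI[of _ e']) auto
  next
    case False
    then obtain w where w: "w \<in> V" "l k w \<noteq> 0" by blast
    define v where "v = (\<lambda>z. inverse (l k w) * w z)"
    have v: "v \<in> V" "l k v = 1"
      using w linear_functional_scale[OF lk w(1)] function_space_scale[OF V w(1)]
      by (auto simp: v_def)
    \<comment> \<open>Subtracting \<open>l k u\<close> times v puts u into the kernel, where e
      expands it with coefficients \<open>l m u - l k u * l m v\<close>; collecting the multiples of
      \<open>l k u\<close> leaves exactly d.\<close>
    define d where "d = (\<lambda>z. v z + (-1) * (\<Sum>m\<in>M. l m v * e m z))"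
    have eV: "e m \<in> V" if "m \<in> M" for m using e[OF that] by (simp add: V0_def)
    have d: "d \<in> V"
      unfolding d_def
      by (intro function_space_add[OF V] function_space_scale[OF V] v(1)
          function_space_sum[OF V insert.hyps(1)] eV)
    define e' where "e' = e(k := d)"
    have "u = (\<lambda>z. \<Sum>m\<in>insert k M. l m u * e' m z)" if u: "u \<in> V" for u
    proof -
      define u0 where "u0 = (\<lambda>z. u z + (- l k u) * v z)"
      have lu0: "l m u0 = l m u + (- l k u) * l m v" if "m \<in> insert k M" for m
        unfolding u0_def
        using linear_functional_add[OF insert.prems(2)[OF that] u function_space_scale[OF V v(1)]]
          linear_functional_scale[OF insert.prems(2)[OF that] v(1)] by metis
      have "u0 \<in> V0"
        using lu0[of k] v function_space_add[OF V u function_space_scale[OF V v(1), of "- l k u"]]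
        unfolding V0_def u0_def by auto
      then have "u0 = (\<lambda>z. \<Sum>m\<in>M. l m u0 * e m z)" by (rule ex)
      from fun_cong[OF this]
      have "u0 z = (\<Sum>m\<in>M. (l m u + (- l k u) * l m v) * e m z)" for z
        using lu0 by simp
      then have "u z = l k u * v z + (\<Sum>m\<in>M. (l m u + (- l k u) * l m v) * e m z)" for z
        by (simp add: u0_def algebra_simps)
      moreover have "(\<Sum>m\<in>M. (l m u + (- l k u) * l m v) * e m z) =
          (\<Sum>m\<in>M. l m u * e m z) + (- l k u) * (\<Sum>m\<in>M. l m v * e m z)" for z
        by (simp add: sum_distrib_left left_diff_distrib sum_subtractf sum_negf mult.assoc)
      ultimately have "u z = l k u * d z + (\<Sum>m\<in>M. l m u * e m z)" for z
        by (simp add: d_def algebra_simps)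
      moreover have "(\<Sum>m\<in>insert k M. l m u * e' m z) = l k u * d z + (\<Sum>m\<in>M. l m u * e m z)" for z
        using insert.hyps by (simp add: e'_def) (intro sum.cong, auto)
      ultimately show ?thesis by auto
    qed
    moreover have "\<forall>m\<in>insert k M. e' m \<in> V" using d eV by (auto simp: e'_def)
    ultimately show ?thesis by blast
  qed
qed

section \<open>Linear extension to the free vector space\<close>

abbreviation free_basis :: "'b \<Rightarrow> ('b \<Rightarrow>\<^sub>0 complex)" where
  "free_basis f \<equiv> Poly_Mapping.single f 1"

definition free_extend :: "('b \<Rightarrow> complex) \<Rightarrow> ('b \<Rightarrow>\<^sub>0 complex) \<Rightarrow> complex" where
  "free_extend \<Lambda> x = (\<Sum>f\<in>Poly_Mapping.keys x. Poly_Mapping.lookup x f * \<Lambda> f)"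

text \<open>Summing over a common finite superset of the supports lets linearity be read off
  termwise, even when terms cancel.\<close>

lemma free_extend_superset:
  "finite S \<Longrightarrow> Poly_Mapping.keys x \<subseteq> S \<Longrightarrow>
    free_extend \<Lambda> x = (\<Sum>f\<in>S. Poly_Mapping.lookup x f * \<Lambda> f)"
  unfolding free_extend_def by (rule sum.mono_neutral_left) (auto simp: in_keys_iff)

lemma free_extend_add: "free_extend \<Lambda> (x + y) = free_extend \<Lambda> x + free_extend \<Lambda> y"
proof -
  let ?S = "Poly_Mapping.keys x \<union> Poly_Mapping.keys y"
  have "Poly_Mapping.keys (x + y) \<subseteq> ?S" by (rule Poly_Mapping.keys_add)
  then show ?thesis
    by (simp add: free_extend_superset[of ?S] lookup_add distrib_right sum.distrib)
qed

lemma keys_free_scale: "Poly_Mapping.keys (free_scale c x) \<subseteq> Poly_Mapping.keys x"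
  by (auto simp: in_keys_iff)

lemma free_extend_scale: "free_extend \<Lambda> (free_scale c x) = c * free_extend \<Lambda> x"
  using keys_free_scale[of c x]
  by (simp add: free_extend_superset[of "Poly_Mapping.keys x"] sum_distrib_left mult.assoc)

lemma free_extend_diff: "free_extend \<Lambda> (x - y) = free_extend \<Lambda> x - free_extend \<Lambda> y"
  using free_extend_add[of \<Lambda> "x - y" y] by simp

lemma free_extend_basis [simp]: "free_extend \<Lambda> (free_basis f) = \<Lambda> f"
  by (simp add: free_extend_def)

lemma free_extend_cong:
  "(\<And>f. f \<in> Poly_Mapping.keys x \<Longrightarrow> \<Lambda> f = \<Lambda>' f) \<Longrightarrow> free_extend \<Lambda> x = free_extend \<Lambda>' x"
  unfolding free_extend_def by (rule sum.cong) auto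

lemma free_extend_sum:
  "free_extend (\<lambda>f. \<Sum>\<sigma>\<in>S. \<Lambda> \<sigma> f) x = (\<Sum>\<sigma>\<in>S. free_extend (\<Lambda> \<sigma>) x)"
  unfolding free_extend_def sum_distrib_left by (rule sum.swap)

lemma free_basis_expansion:
  "x = (\<Sum>f\<in>Poly_Mapping.keys x. free_scale (Poly_Mapping.lookup x f) (free_basis f))"
  by (rule poly_mapping_eqI)
    (auto simp: lookup_sum lookup_single when_def in_keys_iff if_distrib cong: if_cong)

lemma free_space_basis: "f \<in> PiE I V \<Longrightarrow> free_basis f \<in> free_space I V"
  by (auto simp: free_space_def)

lemma free_space_add: "x \<in> free_space I V \<Longrightarrow> y \<in> free_space I V \<Longrightarrow> x + y \<in> free_space I V"
  using Poly_Mapping.keys_add[of x y] by (auto simp: free_space_def)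

lemma free_space_scale: "x \<in> free_space I V \<Longrightarrow> free_scale c x \<in> free_space I V"
  using keys_free_scale[of c x] by (auto simp: free_space_def)

lemma free_space_zero: "0 \<in> free_space I V"
  by (simp add: free_space_def)

lemma free_space_diff: "x \<in> free_space I V \<Longrightarrow> y \<in> free_space I V \<Longrightarrow> x - y \<in> free_space I V"
  using free_space_add[of x I V "free_scale (-1) y"] free_space_scale[of y I V "-1"] by simp

lemma free_space_sum: "(\<And>i. i \<in> S \<Longrightarrow> x i \<in> free_space I V) \<Longrightarrow> sum x S \<in> free_space I V"
  by (induction S rule: infinite_finite_induct) (auto intro: free_space_zero free_space_add)

section \<open>Computing modulo the multilinearity relations\<close>

lemma tensor_relations_trans:
  "x - y \<in> tensor_relations I V \<Longrightarrow> y - z \<in> tensor_relations I V \<Longrightarrow> x - z \<in> tensor_relations I V"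
  using free.span_add[of "x - y" _ "y - z"] unfolding tensor_relations_def by fastforce

lemma tensor_relations_sum:
  assumes "\<And>i. i \<in> S \<Longrightarrow> x i - y i \<in> tensor_relations I V"
  shows "(\<Sum>i\<in>S. free_scale (c i) (x i)) - (\<Sum>i\<in>S. free_scale (c i) (y i)) \<in> tensor_relations I V"
proof -
  have "(\<Sum>i\<in>S. free_scale (c i) (x i - y i)) \<in> tensor_relations I V"
    using assms unfolding tensor_relations_def by (intro free.span_sum free.span_scale) auto
  then show ?thesis by (simp add: free.scale_right_diff_distrib sum_subtractf)
qed

lemma free_basis_add_relation:
  assumes "f \<in> PiE I V" "j \<in> I" "u \<in> V j" "v \<in> V j"
  shows "free_basis (f(j := (\<lambda>z. u z + v z))) - free_basis (f(j := u)) - free_basis (f(j := v))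
    \<in> tensor_relations I V"
  unfolding tensor_relations_def
  by (rule free.span_base, rule UnI1) (use assms in blast)

lemma free_basis_scale_relation:
  assumes "f \<in> PiE I V" "j \<in> I" "u \<in> V j"
  shows "free_basis (f(j := (\<lambda>z. c * u z))) - free_scale c (free_basis (f(j := u)))
    \<in> tensor_relations I V"
  unfolding tensor_relations_def
  by (rule free.span_base, rule UnI2) (use assms in blast)

lemma free_basis_sum_relation:
  assumes f: "f \<in> PiE I V" "j \<in> I" and V: "function_space (V j)"
    and "finite M" "\<And>m. m \<in> M \<Longrightarrow> u m \<in> V j"
  shows "free_basis (f(j := (\<lambda>z. \<Sum>m\<in>M. c m * u m z)))
    - (\<Sum>m\<in>M. free_scale (c m) (free_basis (f(j := u m)))) \<in> tensor_relations I V"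
  using assms(4,5)
proof (induction M rule: finite_induct)
  case empty
  \<comment> \<open>The scaling relation with c = 0 says that a basis vector with a zero entry is
    itself a relation.\<close>
  then show ?case
    using free_basis_scale_relation[where c = 0, OF f function_space_zero[OF V]]
    by (simp add: fun_upd_def)
next
  case (insert m M)
  let ?U = "\<lambda>z. \<Sum>m\<in>M. c m * u m z"
  have um: "u m \<in> V j" and "?U \<in> V j" "(\<lambda>z. c m * u m z) \<in> V j"
    using insert by (auto intro: function_space_sum function_space_scale V)
  have 1: "free_basis (f(j := (\<lambda>z. c m * u m z + ?U z))) - free_basis (f(j := (\<lambda>z. c m * u m z)))
      - free_basis (f(j := ?U)) \<in> tensor_relations I V"
    by (rule free_basis_add_relation) fact+
  have 2: "free_basis (f(j := (\<lambda>z. c m * u m z))) - free_scale (c m) (free_basis (f(j := u m)))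
      \<in> tensor_relations I V"
    by (rule free_basis_scale_relation) fact+
  have 3: "free_basis (f(j := ?U))
    - (\<Sum>m\<in>M. free_scale (c m) (free_basis (f(j := u m)))) \<in> tensor_relations I V"
    by (rule insert.IH) (use insert.prems in auto)
  from free.span_add[OF free.span_add[OF 1[unfolded tensor_relations_def]
      2[unfolded tensor_relations_def]] 3[unfolded tensor_relations_def]]
  show ?case using insert.hyps
    unfolding tensor_relations_def[symmetric] by (simp add: fun_upd_def algebra_simps)
qed

lemma sum_PiE_insert:
  assumes "j \<notin> J"
  shows "(\<Sum>\<mu>\<in>PiE (insert j J) M. g \<mu>) = (\<Sum>\<mu>\<in>PiE J M. \<Sum>m\<in>M j. g (\<mu>(j := m)))"
proof -
  have "(\<Sum>\<mu>\<in>PiE (insert j J) M. g \<mu>) = (\<Sum>(m, \<mu>)\<in>M j \<times> PiE J M. g (\<mu>(j := m)))"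
    unfolding PiE_insert_eq
    by (subst sum.reindex[OF inj_combinator[OF assms]]) (auto intro: sum.cong)
  also have "\<dots> = (\<Sum>m\<in>M j. \<Sum>\<mu>\<in>PiE J M. g (\<mu>(j := m)))"
    by (rule sum.cartesian_product[symmetric])
  also have "\<dots> = (\<Sum>\<mu>\<in>PiE J M. \<Sum>m\<in>M j. g (\<mu>(j := m)))"
    by (rule sum.swap)
  finally show ?thesis .
qed

text \<open>The slots in J are already expanded in the vectors e, the others still hold f; each
  induction step expands one more slot of every term. For \<open>J = I\<close> the remaining tensors
  no longer depend on f.\<close>

lemma multilinear_expansion_relation:
  assumes f: "f \<in> PiE I V" and V: "\<And>j. j \<in> I \<Longrightarrow> function_space (V j)"
    and M: "\<And>j. j \<in> I \<Longrightarrow> finite (M j)"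
    and e: "\<And>j m. j \<in> I \<Longrightarrow> m \<in> M j \<Longrightarrow> e j m \<in> V j"
    and ex: "\<And>j u. j \<in> I \<Longrightarrow> u \<in> V j \<Longrightarrow> u = (\<lambda>z. \<Sum>m\<in>M j. l j m u * e j m z)"
    and "finite J" "J \<subseteq> I"
  shows "free_basis f - (\<Sum>\<mu>\<in>PiE J M. free_scale (\<Prod>j\<in>J. l j (\<mu> j) (f j))
      (free_basis (\<lambda>i. if i \<in> J then e i (\<mu> i) else f i))) \<in> tensor_relations I V"
  using assms(6,7)
proof (induction J rule: finite_induct)
  case empty
  then show ?case by (simp add: tensor_relations_def free.span_zero)
next
  case (insert j J)
  then have j: "j \<in> I" and J: "J \<subseteq> I" by auto
  define g where "g \<mu> = (\<lambda>i. if i \<in> J then e i (\<mu> i) else f i)" for \<mu>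
  define c where "c \<mu> = (\<Prod>j\<in>J. l j (\<mu> j) (f j))" for \<mu>
  have fj: "f j \<in> V j" using f j by auto
  have "(\<Sum>\<mu>\<in>PiE J M. free_scale (c \<mu>) (free_basis (g \<mu>))) - (\<Sum>\<mu>\<in>PiE J M. free_scale (c \<mu>)
        (\<Sum>m\<in>M j. free_scale (l j m (f j)) (free_basis ((g \<mu>)(j := e j m))))) \<in> tensor_relations I V"
  proof (rule tensor_relations_sum)
    fix \<mu> assume \<mu>: "\<mu> \<in> PiE J M"
    have "g \<mu> \<in> PiE I V"
    proof (rule PiE_I)
      show "g \<mu> i \<in> V i" if "i \<in> I" for i
        using that f \<mu> e[of i "\<mu> i"] by (auto simp: g_def)
      show "g \<mu> i = undefined" if "i \<notin> I" for i
        using that f J by (auto simp: g_def)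
    qed
    from free_basis_sum_relation[OF this j V[OF j] M[OF j] e[OF j], of "\<lambda>m. m" "\<lambda>m. l j m (f j)"]
    have "free_basis ((g \<mu>)(j := (\<lambda>z. \<Sum>m\<in>M j. l j m (f j) * e j m z)))
      - (\<Sum>m\<in>M j. free_scale (l j m (f j)) (free_basis ((g \<mu>)(j := e j m)))) \<in> tensor_relations I V"
      by simp
    also have "(\<lambda>z. \<Sum>m\<in>M j. l j m (f j) * e j m z) = f j"
      using ex[OF j fj] by simp
    also have "(g \<mu>)(j := f j) = g \<mu>"
      using insert.hyps by (auto simp: g_def)
    finally show "free_basis (g \<mu>)
      - (\<Sum>m\<in>M j. free_scale (l j m (f j)) (free_basis ((g \<mu>)(j := e j m)))) \<in> tensor_relations I V" .
  qed
  with insert.IH[OF J] have "free_basis f - (\<Sum>\<mu>\<in>PiE J M. free_scale (c \<mu>)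
      (\<Sum>m\<in>M j. free_scale (l j m (f j)) (free_basis ((g \<mu>)(j := e j m))))) \<in> tensor_relations I V"
    unfolding g_def c_def by (rule tensor_relations_trans)
  also have "(\<Sum>\<mu>\<in>PiE J M. free_scale (c \<mu>)
      (\<Sum>m\<in>M j. free_scale (l j m (f j)) (free_basis ((g \<mu>)(j := e j m))))) =
      (\<Sum>\<mu>\<in>PiE (insert j J) M. free_scale (\<Prod>j\<in>insert j J. l j (\<mu> j) (f j))
      (free_basis (\<lambda>i. if i \<in> insert j J then e i (\<mu> i) else f i)))"
    unfolding sum_PiE_insert[OF insert.hyps(2)] free.scale_sum_right
  proof (intro sum.cong refl)
    fix \<mu> m
    have 1: "(\<Prod>i\<in>insert j J. l i ((\<mu>(j := m)) i) (f i)) = c \<mu> * l j m (f j)"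
    proof -
      have "(\<Prod>i\<in>J. l i ((\<mu>(j := m)) i) (f i)) = c \<mu>"
        using insert.hyps unfolding c_def by (intro prod.cong) auto
      then show ?thesis using insert.hyps by simp
    qed
    have 2: "(\<lambda>i. if i \<in> insert j J then e i ((\<mu>(j := m)) i) else f i) = (g \<mu>)(j := e j m)"
      using insert.hyps by (auto simp: g_def fun_eq_iff)
    show "free_scale (c \<mu>) (free_scale (l j m (f j)) (free_basis ((g \<mu>)(j := e j m)))) =
      free_scale (\<Prod>i\<in>insert j J. l i ((\<mu>(j := m)) i) (f i))
        (free_basis (\<lambda>i. if i \<in> insert j J then e i ((\<mu>(j := m)) i) else f i))"
      unfolding 1 2 by simp
  qed
  finally show ?case .
qed

text \<open>A tensor product of injective maps is injective: after full expansion the coefficient of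
  the tensor indexed by \<open>\<mu>\<close> is the value of the product functional
  \<open>\<mu>\<close> on x, so every coefficient vanishes.\<close>

lemma tensor_relations_separation:
  assumes I: "finite I" and V: "\<And>j. j \<in> I \<Longrightarrow> function_space (V j)"
    and M: "\<And>j. j \<in> I \<Longrightarrow> finite (M j)"
    and l: "\<And>j m. j \<in> I \<Longrightarrow> m \<in> M j \<Longrightarrow> linear_functional (V j) (l j m)"
    and sep: "\<And>j u. j \<in> I \<Longrightarrow> u \<in> V j \<Longrightarrow> (\<And>m. m \<in> M j \<Longrightarrow> l j m u = 0) \<Longrightarrow> u = (\<lambda>_. 0)"
    and x: "x \<in> free_space I V"
    and zero: "\<And>\<mu>. \<mu> \<in> PiE I M \<Longrightarrow> free_extend (\<lambda>f. \<Prod>j\<in>I. l j (\<mu> j) (f j)) x = 0"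
  shows "x \<in> tensor_relations I V"
proof -
  have "\<forall>j\<in>I. \<exists>e. (\<forall>m\<in>M j. e m \<in> V j) \<and> (\<forall>u\<in>V j. u = (\<lambda>z. \<Sum>m\<in>M j. l j m u * e m z))"
    using separating_functionals_dual_system[OF M V l sep] by simp
  from bchoice[OF this]
  obtain e where e: "\<And>j m. j \<in> I \<Longrightarrow> m \<in> M j \<Longrightarrow> e j m \<in> V j"
    and ex: "\<And>j u. j \<in> I \<Longrightarrow> u \<in> V j \<Longrightarrow> u = (\<lambda>z. \<Sum>m\<in>M j. l j m u * e j m z)"
    by blast
  let ?K = "Poly_Mapping.keys x"
  define b where "b f \<mu> = free_basis (\<lambda>i. if i \<in> I then e i (\<mu> i) else f i)"
    for f :: "'a \<Rightarrow> 'b \<Rightarrow> complex" and \<mu>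
  \<comment> \<open>All families in \<open>PiE I V\<close> are \<open>undefined\<close> off I, so
    the fully expanded tensors of different f coincide and their coefficients may be added.\<close>
  have b: "b f \<mu> = b (\<lambda>_. undefined) \<mu>" if "f \<in> PiE I V" for f \<mu>
    using that unfolding b_def by (intro arg_cong[where f = free_basis]) (auto simp: fun_eq_iff)
  have K: "f \<in> PiE I V" if "f \<in> ?K" for f
    using x that by (auto simp: free_space_def)
  have "(\<Sum>f\<in>?K. free_scale (Poly_Mapping.lookup x f) (free_basis f)) -
      (\<Sum>f\<in>?K. free_scale (Poly_Mapping.lookup x f)
        (\<Sum>\<mu>\<in>PiE I M. free_scale (\<Prod>j\<in>I. l j (\<mu> j) (f j)) (b f \<mu>))) \<in> tensor_relations I V"
    unfolding b_def
    by (rule tensor_relations_sum, rule multilinear_expansion_relation) (use K V M e ex I in auto)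
  also have "(\<Sum>f\<in>?K. free_scale (Poly_Mapping.lookup x f)
        (\<Sum>\<mu>\<in>PiE I M. free_scale (\<Prod>j\<in>I. l j (\<mu> j) (f j)) (b f \<mu>))) =
      (\<Sum>f\<in>?K. \<Sum>\<mu>\<in>PiE I M. free_scale (Poly_Mapping.lookup x f * (\<Prod>j\<in>I. l j (\<mu> j) (f j)))
        (b (\<lambda>_. undefined) \<mu>))"
    by (intro sum.cong refl) (simp add: b[OF K] free.scale_sum_right)
  also have "\<dots> = (\<Sum>\<mu>\<in>PiE I M. free_scale (free_extend (\<lambda>f. \<Prod>j\<in>I. l j (\<mu> j) (f j)) x)
        (b (\<lambda>_. undefined) \<mu>))"
    unfolding free_extend_def free.scale_sum_left by (rule sum.swap)
  also have "\<dots> = 0"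
    using zero by simp
  finally show ?thesis
    using free_basis_expansion[of x] by simp
qed

section \<open>Universal property of the tensor product\<close>

definition multilinear_on ::
  "'i set \<Rightarrow> ('i \<Rightarrow> ('a \<Rightarrow> complex) set) \<Rightarrow> (('i \<Rightarrow> 'a \<Rightarrow> complex) \<Rightarrow> complex) \<Rightarrow> bool" where
  "multilinear_on I V \<Lambda> \<longleftrightarrow> (\<forall>f\<in>PiE I V. \<forall>j\<in>I. linear_functional (V j) (\<lambda>u. \<Lambda> (f(j := u))))"

text \<open>The kernel of \<open>free_extend \<Lambda>\<close> is a subspace, and linearity in each
  slot puts both kinds of generators into it. Hence the extension descends to the quotient.\<close>

lemma free_extend_tensor_relations:
  assumes "multilinear_on I V \<Lambda>" "x \<in> tensor_relations I V"
  shows "free_extend \<Lambda> x = 0"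
  using assms(2) unfolding tensor_relations_def
proof (induction rule: free.span_induct)
  case base
  show ?case
    by (auto simp: free.subspace_def free_extend_add free_extend_scale)
      (simp add: free_extend_def)
next
  case (step x)
  then show ?case
    using assms(1)
    by (auto simp: free_extend_diff free_extend_scale multilinear_on_def linear_functional_def)
qed

text \<open>Existence half of the universal property, for all coordinates p of the target at
  once.\<close>

lemma tensor_lift_exists:
  assumes \<Lambda>: "\<And>p. multilinear_on I V (\<Lambda> p)"
  shows "\<exists>L. tensor_linear I V L \<and>
    (\<forall>x\<in>free_space I V. \<forall>p. L (tensor_class I V x) p = free_extend (\<Lambda> p) x)"
proof -
  \<comment> \<open>The choice is harmless: two representatives differ by a relation, on which the
    extension is 0.\<close>
  define L where "L X p = free_extend (\<Lambda> p) (SOME x. x \<in> X)" for X p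
  have L: "L (tensor_class I V x) p = free_extend (\<Lambda> p) x" if "x \<in> free_space I V" for x p
  proof -
    have "(SOME y. y \<in> tensor_class I V x) \<in> tensor_class I V x"
      using mem_tensor_class_self[OF that] by (rule someI)
    then have "(SOME y. y \<in> tensor_class I V x) - x \<in> tensor_relations I V"
      by (simp add: tensor_class_def)
    from free_extend_tensor_relations[OF \<Lambda>[of p] this] show ?thesis
      by (simp add: L_def free_extend_diff)
  qed
  have "tensor_linear I V L"
    unfolding tensor_linear_def tensor_product_def
    by (auto simp: tensor_add_class tensor_scale_class L free_space_add free_space_scale
        free_extend_add free_extend_scale)
  then show ?thesis using L by blast
qed

text \<open>Uniqueness half: values on pure tensors determine a linear map. This is why injectivity
  can be proved for every period map and not only for the one constructed.\<close>

lemma tensor_linear_class: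
  assumes L: "tensor_linear I V L" and x: "x \<in> free_space I V"
  shows "L (tensor_class I V x) p = free_extend (\<lambda>f. L (pure_tensor I V f) p) x"
proof -
  have add: "L (tensor_class I V (x + y)) p = L (tensor_class I V x) p + L (tensor_class I V y) p"
    if "x \<in> free_space I V" "y \<in> free_space I V" for x y
    using L that by (auto simp: tensor_linear_def tensor_product_def tensor_add_class[symmetric])
  have scale: "L (tensor_class I V (free_scale c x)) p = c * L (tensor_class I V x) p"
    if "x \<in> free_space I V" for c x
    using L that by (auto simp: tensor_linear_def tensor_product_def tensor_scale_class[symmetric])
  have "L (tensor_class I V (\<Sum>f\<in>S. free_scale (c f) (free_basis f))) p =
      (\<Sum>f\<in>S. c f * L (pure_tensor I V f) p)" if "finite S" "S \<subseteq> PiE I V" for S c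
    using that
  proof (induction S rule: finite_induct)
    case empty
    \<comment> \<open>Linearity is stated for sums and multiples only; the value at the class of 0
      comes from scaling by 0.\<close>
    show ?case using scale[OF free_space_zero, of 0] by simp
  next
    case (insert f S)
    have "(\<Sum>f\<in>S. free_scale (c f) (free_basis f)) \<in> free_space I V"
      using insert.prems by (intro free_space_sum free_space_scale free_space_basis) auto
    then show ?case
      using insert by (simp add: add scale free_space_scale free_space_basis pure_tensor_def)
  qed
  from this[of "Poly_Mapping.keys x" "Poly_Mapping.lookup x"] x show ?thesis
    using free_basis_expansion[of x] by (simp add: free_extend_def free_space_def)
qed

section \<open>Decomposition of the orthant into simplices\<close>

text \<open>Fubini in coordinate i: with the other coordinates fixed, the slice of the diagonal lies
  in the single point \<open>t j\<close>, a set of length 0.\<close>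

lemma PiM_lborel_diagonal_null:
  assumes "finite I" "i \<in> I" "j \<in> I" "i \<noteq> j"
  shows "AE t in PiM I (\<lambda>_. lborel :: real measure). t i \<noteq> t j"
proof -
  interpret product_sigma_finite "\<lambda>_. lborel :: real measure" ..
  define J where "J = I - {i}"
  have J: "finite J" "i \<notin> J" "I = insert i J" "j \<in> J"
    using assms by (auto simp: J_def)
  have [measurable]: "{t \<in> space (PiM I (\<lambda>_. lborel)). t i = t j} \<in> sets (PiM I (\<lambda>_. lborel :: real measure))"
    using assms by measurable
  define S where "S = {t \<in> space (PiM I (\<lambda>_. lborel :: real measure)). t i = t j}"
  have S: "S \<in> sets (PiM (insert i J) (\<lambda>_. lborel))"
    using \<open>{t \<in> space _. _} \<in> _\<close> unfolding S_def J(3) .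
  have "emeasure (PiM I (\<lambda>_. lborel)) S = (\<integral>\<^sup>+ t. indicator S t \<partial>PiM (insert i J) (\<lambda>_. lborel))"
    using S J(3) by simp
  also have "\<dots> = (\<integral>\<^sup>+ t. (\<integral>\<^sup>+ y. indicator S (t(i := y)) \<partial>lborel) \<partial>PiM J (\<lambda>_. lborel))"
    using J S by (intro product_nn_integral_insert) auto
  also have "\<dots> \<le> (\<integral>\<^sup>+ t. (\<integral>\<^sup>+ y. indicator {t j} y \<partial>lborel) \<partial>PiM J (\<lambda>_. lborel :: real measure))"
  proof (rule nn_integral_mono)
    fix t :: "'a \<Rightarrow> real"
    show "(\<integral>\<^sup>+ y. indicator S (t(i := y)) \<partial>lborel) \<le> (\<integral>\<^sup>+ y. indicator {t j} y \<partial>lborel)"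
      by (rule nn_integral_mono) (use \<open>i \<noteq> j\<close> in \<open>auto simp: S_def split: split_indicator\<close>)
  qed
  also have "\<dots> = 0" by simp
  finally have "emeasure (PiM I (\<lambda>_. lborel)) S = 0" by simp
  then show ?thesis
    using S J(3) by (intro AE_I[of _ _ S]) (auto simp: S_def)
qed

lemma PiM_lborel_AE_inj_on:
  assumes "finite I"
  shows "AE t in PiM I (\<lambda>_. lborel :: real measure). inj_on t I"
proof -
  have "AE t in PiM I (\<lambda>_. lborel :: real measure). \<forall>i\<in>I. \<forall>j\<in>I. i \<noteq> j \<longrightarrow> t i \<noteq> t j"
    using assms PiM_lborel_diagonal_null[OF assms] by (intro AE_finite_allI) auto
  then show ?thesis by (rule AE_mp) (auto simp: inj_on_def intro!: AE_I2)
qed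

text \<open>A product measure is determined by its values on boxes. The preimage of the box with
  sides \<open>A i\<close> has sides \<open>A (inv \<sigma> i)\<close>, so only the order of the
  factors changes.\<close>

lemma distr_PiM_permutes:
  assumes "finite I" "\<sigma> permutes I" "sigma_finite_measure M"
  shows "distr (PiM I (\<lambda>_. M)) (PiM I (\<lambda>_. M)) (\<lambda>t. \<lambda>i\<in>I. t (\<sigma> i)) = PiM I (\<lambda>_. M)"
proof -
  interpret product_sigma_finite "\<lambda>_. M"
    using assms(3) by (simp add: product_sigma_finite_def)
  have \<sigma>: "\<sigma> i \<in> I \<longleftrightarrow> i \<in> I" for i
    using permutes_in_image[OF assms(2)] .
  have meas: "(\<lambda>t. \<lambda>i\<in>I. t (\<sigma> i)) \<in> PiM I (\<lambda>_. M) \<rightarrow>\<^sub>M PiM I (\<lambda>_. M)"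
    using \<sigma> by (intro measurable_restrict measurable_component_singleton) auto
  show ?thesis
  proof (rule PiM_eqI[OF assms(1)])
    fix A assume A: "\<And>i. i \<in> I \<Longrightarrow> A i \<in> sets M"
    have "emeasure (distr (PiM I (\<lambda>_. M)) (PiM I (\<lambda>_. M)) (\<lambda>t. \<lambda>i\<in>I. t (\<sigma> i))) (Pi\<^sub>E I A) =
      emeasure (PiM I (\<lambda>_. M)) ((\<lambda>t. \<lambda>i\<in>I. t (\<sigma> i)) -` Pi\<^sub>E I A \<inter> space (PiM I (\<lambda>_. M)))"
      using A assms(1) meas by (intro emeasure_distr sets_PiM_I_finite) auto
    also have "(\<lambda>t. \<lambda>i\<in>I. t (\<sigma> i)) -` Pi\<^sub>E I A \<inter> space (PiM I (\<lambda>_. M)) = Pi\<^sub>E I (A \<circ> inv \<sigma>)"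
    proof (rule set_eqI)
      fix t
      have "(\<forall>i\<in>I. t (\<sigma> i) \<in> A i) \<longleftrightarrow> (\<forall>i\<in>I. t i \<in> A (inv \<sigma> i))"
        by (metis \<sigma> assms(2) permutes_inverses(1) permutes_inverses(2))
      moreover have "A (inv \<sigma> i) \<subseteq> space M" if "i \<in> I" for i
        using A[of "inv \<sigma> i"] sets.sets_into_space that \<sigma>[of "inv \<sigma> i"] permutes_inverses(1)[OF assms(2)]
        by auto
      ultimately show "t \<in> (\<lambda>t. \<lambda>i\<in>I. t (\<sigma> i)) -` Pi\<^sub>E I A \<inter> space (PiM I (\<lambda>_. M)) \<longleftrightarrow> t \<in> Pi\<^sub>E I (A \<circ> inv \<sigma>)"
        by (auto simp: space_PiM PiE_iff)
    qed
    also have "emeasure (PiM I (\<lambda>_. M)) (Pi\<^sub>E I (A \<circ> inv \<sigma>)) = (\<Prod>i\<in>I. emeasure M ((A \<circ> inv \<sigma>) i))"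
    proof (rule emeasure_PiM[OF assms(1)])
      show "(A \<circ> inv \<sigma>) i \<in> sets M" if "i \<in> I" for i
        using A[of "inv \<sigma> i"] that \<sigma>[of "inv \<sigma> i"] permutes_inverses(1)[OF assms(2)] by simp
    qed
    also have "\<dots> = (\<Prod>i\<in>I. emeasure M (A i))"
      using prod.permute[OF permutes_inv[OF assms(2)], of "\<lambda>i. emeasure M (A i)"]
      by (simp add: o_def)
    finally show "emeasure (distr (PiM I (\<lambda>_. M)) (PiM I (\<lambda>_. M)) (\<lambda>t. \<lambda>i\<in>I. t (\<sigma> i))) (Pi\<^sub>E I A) =
      (\<Prod>i\<in>I. emeasure M (A i))" .
  qed simp
qed

text \<open>Existence: send i to the index of the i-th smallest value. Uniqueness: along any such
  permutation the values form the strictly increasing enumeration of the same set, and t is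
  injective.\<close>

lemma ex1_sorting_permutation:
  fixes t :: "nat \<Rightarrow> real"
  assumes "inj_on t {1..n}"
  shows "\<exists>!\<sigma>. \<sigma> permutes {1..n} \<and> strict_mono_on {1..n} (t \<circ> \<sigma>)"
proof (rule ex_ex1I)
  define xs where "xs = sorted_list_of_set (t ` {1..n})"
  have xs: "sorted_wrt (<) xs" "set xs = t ` {1..n}" "length xs = n"
    using assms by (auto simp: xs_def card_image)
  \<comment> \<open>Positions count from 1 and list entries from 0, hence \<open>i - 1\<close>;
    outside the range \<open>permutes\<close> demands the identity.\<close>
  define \<sigma> where "\<sigma> i = (if i \<in> {1..n} then the_inv_into {1..n} t (xs ! (i - 1)) else i)" for i
  have nth: "xs ! (i - 1) \<in> t ` {1..n}" if "i \<in> {1..n}" for i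
    using that xs by (metis atLeastAtMost_iff diff_less less_le_trans nth_mem zero_less_one
        One_nat_def Suc_le_eq diff_Suc_less)
  have t\<sigma>: "t (\<sigma> i) = xs ! (i - 1)" if "i \<in> {1..n}" for i
    using f_the_inv_into_f[OF assms nth[OF that]] that by (simp add: \<sigma>_def)
  have mono: "strict_mono_on {1..n} (t \<circ> \<sigma>)"
  proof (rule strict_mono_onI)
    fix i j assume "i \<in> {1..n}" "j \<in> {1..n}" "i < j"
    then show "(t \<circ> \<sigma>) i < (t \<circ> \<sigma>) j"
      using xs by (auto simp: t\<sigma> intro!: sorted_wrt_nth_less[of "(<)" xs])
  qed
  have into: "\<sigma> i \<in> {1..n}" if "i \<in> {1..n}" for i
    using the_inv_into_into[OF assms nth[OF that], of "{1..n}"] that by (simp add: \<sigma>_def)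
  have "inj_on \<sigma> {1..n}"
    using strict_mono_on_imp_inj_on[OF mono] by (rule inj_on_imageI2)
  then have "bij_betw \<sigma> {1..n} {1..n}"
    using into by (simp add: bij_betw_def endo_inj_surj image_subset_iff)
  then have "\<sigma> permutes {1..n}"
    by (rule bij_imp_permutes) (auto simp: \<sigma>_def)
  with mono show "\<exists>\<sigma>. \<sigma> permutes {1..n} \<and> strict_mono_on {1..n} (t \<circ> \<sigma>)" by blast
next
  fix \<sigma> \<tau>
  assume \<sigma>: "\<sigma> permutes {1..n} \<and> strict_mono_on {1..n} (t \<circ> \<sigma>)"
    and \<tau>: "\<tau> permutes {1..n} \<and> strict_mono_on {1..n} (t \<circ> \<tau>)"
  have enum: "map (t \<circ> \<rho>) [1..<Suc n] = sorted_list_of_set (t ` {1..n})"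
    if "\<rho> permutes {1..n}" "strict_mono_on {1..n} (t \<circ> \<rho>)" for \<rho>
  proof (rule sorted_distinct_set_unique)
    have "sorted_wrt (<) (map (t \<circ> \<rho>) [1..<Suc n])"
      using that(2) by (auto simp: sorted_wrt_iff_nth_less strict_mono_on_def simp del: upt_Suc)
    then show "sorted (map (t \<circ> \<rho>) [1..<Suc n])" "distinct (map (t \<circ> \<rho>) [1..<Suc n])"
      by (simp_all add: strict_sorted_iff)
    show "set (map (t \<circ> \<rho>) [1..<Suc n]) = set (sorted_list_of_set (t ` {1..n}))"
      using image_comp[of t \<rho> "{1..n}"] permutes_image[OF that(1)]
      by (simp add: atLeastLessThanSuc_atLeastAtMost del: upt_Suc)
  qed auto
  have "map (t \<circ> \<sigma>) [1..<Suc n] = map (t \<circ> \<tau>) [1..<Suc n]"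
    using enum \<sigma> \<tau> by metis
  then have "t (\<sigma> i) = t (\<tau> i)" if "i \<in> {1..n}" for i
    using that by (auto simp del: upt_Suc)
  then have "\<sigma> i = \<tau> i" if "i \<in> {1..n}" for i
    using that \<sigma> \<tau> assms by (metis inj_onD permutes_in_image)
  then show "\<sigma> = \<tau>"
    using \<sigma> \<tau> by (metis ext permutes_not_in)
qed

definition positive_simplex :: "nat \<Rightarrow> (nat \<Rightarrow> real) set" where
  "positive_simplex n = {t. (\<forall>j\<in>{1..n}. 0 < t j) \<and> strict_mono_on {1..n} t}"

text \<open>
  On \<open>chamber\<close> positivity is moved into the factors of the integrand, which makes them
  functions on the whole line.
\<close>

definition chamber :: "nat \<Rightarrow> (nat \<Rightarrow> real) set" where
  "chamber n = {t \<in> space (PiM {1..n} (\<lambda>_. lborel)). strict_mono_on {1..n} t}"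

lemma chamber_measurable [measurable]: "chamber n \<in> sets (PiM {1..n} (\<lambda>_. lborel))"
  unfolding chamber_def strict_mono_on_def by measurable

text \<open>Inside the space of the product measure the simplex can be traded for the measurable
  \<open>chamber\<close>, and positivity becomes one factor per coordinate, which Fubini can
  separate.\<close>

lemma positive_simplex_prod:
  fixes g :: "nat \<Rightarrow> real \<Rightarrow> complex"
  assumes "t \<in> space (PiM {1..n} (\<lambda>_. lborel :: real measure))"
  shows "indicator (positive_simplex n) t *\<^sub>R (\<Prod>j=1..n. g j (t j)) =
    indicator (chamber n) t *\<^sub>R (\<Prod>j=1..n. indicator {0<..} (t j) *\<^sub>R g j (t j))"
proof (cases "\<forall>j\<in>{1..n}. 0 < t j")
  case True
  then have "(\<Prod>j=1..n. indicator {0<..} (t j) *\<^sub>R g j (t j)) = (\<Prod>j=1..n. g j (t j))"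
    by (intro prod.cong) auto
  with True assms show ?thesis by (simp add: chamber_def positive_simplex_def indicator_def)
next
  case False
  then obtain j where "j \<in> {1..n}" "\<not> 0 < t j" by blast
  then have "(\<Prod>j=1..n. indicator {0<..} (t j) *\<^sub>R g j (t j)) = 0"
    by (intro prod_zero bexI[of _ j]) auto
  with False show ?thesis by (auto simp: positive_simplex_def indicator_def)
qed

lemma product_integrable_lborel:
  fixes g :: "nat \<Rightarrow> real \<Rightarrow> complex"
  assumes "\<And>j. j \<in> {1..n} \<Longrightarrow> set_integrable lborel {0<..} (g j)"
  shows "integrable (PiM {1..n} (\<lambda>_. lborel)) (\<lambda>t. \<Prod>j=1..n. indicator {0<..} (t j) *\<^sub>R g j (t j))"
    and "(LINT t | PiM {1..n} (\<lambda>_. lborel). (\<Prod>j=1..n. indicator {0<..} (t j) *\<^sub>R g j (t j))) =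
      (\<Prod>j=1..n. LINT t : {0<..} | lborel. g j t)"
proof -
  interpret product_sigma_finite "\<lambda>_. lborel :: real measure" ..
  have "integrable lborel (\<lambda>t. indicator {0<..} t *\<^sub>R g j t)" if "j \<in> {1..n}" for j
    using assms[OF that] by (simp add: set_integrable_def)
  then show "integrable (PiM {1..n} (\<lambda>_. lborel)) (\<lambda>t. \<Prod>j=1..n. indicator {0<..} (t j) *\<^sub>R g j (t j))"
    "(LINT t | PiM {1..n} (\<lambda>_. lborel). (\<Prod>j=1..n. indicator {0<..} (t j) *\<^sub>R g j (t j))) =
      (\<Prod>j=1..n. LINT t : {0<..} | lborel. g j t)"
    unfolding set_lebesgue_integral_def
    by (auto intro!: product_integrable_prod product_integral_prod)
qed

lemma positive_simplex_set_integrable: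
  fixes g :: "nat \<Rightarrow> real \<Rightarrow> complex"
  assumes "\<And>j. j \<in> {1..n} \<Longrightarrow> set_integrable lborel {0<..} (g j)"
  shows "set_integrable (PiM {1..n} (\<lambda>_. lborel)) (positive_simplex n) (\<lambda>t. \<Prod>j=1..n. g j (t j))"
  unfolding set_integrable_def
  by (subst Bochner_Integration.integrable_cong[OF refl positive_simplex_prod], assumption)
    (rule integrable_mult_indicator[OF chamber_measurable product_integrable_lborel(1)[OF assms]])

text \<open>Relabelling the coordinates by \<open>\<sigma>\<close> turns every integrand into the
  same function H and moves \<open>\<sigma>\<close> into the region. The regions are disjoint and
  miss only points with two equal coordinates, so their integrals add up to that of H, which
  factors.\<close>

lemma sum_permuted_simplex_integrals:
  fixes g :: "nat \<Rightarrow> real \<Rightarrow> complex"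
  assumes g: "\<And>j. j \<in> {1..n} \<Longrightarrow> set_integrable lborel {0<..} (g j)"
  shows "(\<Sum>\<sigma> | \<sigma> permutes {1..n}.
      LINT t : positive_simplex n | PiM {1..n} (\<lambda>_. lborel). \<Prod>j=1..n. g (\<sigma> j) (t j)) =
    (\<Prod>j=1..n. LINT t : {0<..} | lborel. g j t)"
proof -
  let ?P = "PiM {1..n} (\<lambda>_. lborel :: real measure)"
  let ?S = "{\<sigma>. \<sigma> permutes {1..n}}"
  let ?E = "chamber n"
  let ?r = "\<lambda>\<sigma> (t :: nat \<Rightarrow> real). \<lambda>i\<in>{1..n}. t (\<sigma> i)"
  define h where "h j t = indicator {0<..} t *\<^sub>R g j t" for j t
  define H where "H t = (\<Prod>j=1..n. h j (t j))" for t
  have H: "integrable ?P H" "integral\<^sup>L ?P H = (\<Prod>j=1..n. LINT t : {0<..} | lborel. g j t)"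
    unfolding H_def h_def using product_integrable_lborel[of n g] g by auto
  have r: "?r \<sigma> \<in> ?P \<rightarrow>\<^sub>M ?P" if "\<sigma> permutes {1..n}" for \<sigma>
    using permutes_in_image[OF that]
    by (intro measurable_restrict measurable_component_singleton) auto
  have summand: "(LINT t : positive_simplex n | ?P. \<Prod>j=1..n. g (\<sigma> j) (t j)) =
      (LINT t | ?P. indicator ?E (?r \<sigma> t) *\<^sub>R H t)" (is "?lhs = ?rhs")
    if \<sigma>: "\<sigma> permutes {1..n}" for \<sigma>
  proof -
    have g\<sigma>: "set_integrable lborel {0<..} (g (\<sigma> j))" if "j \<in> {1..n}" for j
      using g[of "\<sigma> j"] permutes_in_image[OF \<sigma>] that by auto
    have prodH: "(\<Prod>j=1..n. h (\<sigma> j) (?r \<sigma> t j)) = H t" for t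
    proof -
      have "(\<Prod>j=1..n. h (\<sigma> j) (?r \<sigma> t j)) = (\<Prod>j=1..n. h (\<sigma> j) (t (\<sigma> j)))"
        by (intro prod.cong) auto
      also have "\<dots> = H t"
        unfolding H_def using prod.permute[OF \<sigma>, of "\<lambda>j. h j (t j)"] by (simp add: o_def)
      finally show ?thesis .
    qed
    have "?lhs = (LINT t | ?P. indicator ?E t *\<^sub>R (\<Prod>j=1..n. h (\<sigma> j) (t j)))"
      unfolding set_lebesgue_integral_def h_def
      by (intro Bochner_Integration.integral_cong refl positive_simplex_prod)
    \<comment> \<open>The product measure is its own image under \<open>?r \<sigma>\<close>, so the
      change of variables costs no Jacobian.\<close>
    also have "\<dots> = (LINT t | distr ?P ?P (?r \<sigma>). indicator ?E t *\<^sub>R (\<Prod>j=1..n. h (\<sigma> j) (t j)))"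
      by (simp only: distr_PiM_permutes[OF finite_atLeastAtMost \<sigma> lborel.sigma_finite_measure_axioms])
    also have "\<dots> = (LINT t | ?P. indicator ?E (?r \<sigma> t) *\<^sub>R (\<Prod>j=1..n. h (\<sigma> j) (?r \<sigma> t j)))"
      unfolding h_def
      by (intro integral_distr[OF r[OF \<sigma>]] borel_measurable_scaleR borel_measurable_indicator
          chamber_measurable borel_measurable_integrable[OF product_integrable_lborel(1)[OF g\<sigma>]])
    also have "\<dots> = ?rhs"
      by (simp only: prodH)
    finally show ?thesis .
  qed
  have "(\<Sum>\<sigma>\<in>?S. LINT t : positive_simplex n | ?P. \<Prod>j=1..n. g (\<sigma> j) (t j)) =
      (\<Sum>\<sigma>\<in>?S. LINT t | ?P. indicator ?E (\<lambda>i\<in>{1..n}. t (\<sigma> i)) *\<^sub>R H t)"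
    by (intro sum.cong summand) auto
  also have "\<dots> = (LINT t | ?P. (\<Sum>\<sigma>\<in>?S. indicator ?E (\<lambda>i\<in>{1..n}. t (\<sigma> i)) *\<^sub>R H t))"
  proof (rule Bochner_Integration.integral_sum[symmetric])
    fix \<sigma> assume "\<sigma> \<in> ?S"
    then have "(\<lambda>t. \<lambda>i\<in>{1..n}. t (\<sigma> i)) -` ?E \<inter> space ?P \<in> sets ?P"
      by (intro measurable_sets[OF r chamber_measurable]) auto
    from integrable_mult_indicator[OF this H(1)]
    show "integrable ?P (\<lambda>t. indicator ?E (\<lambda>i\<in>{1..n}. t (\<sigma> i)) *\<^sub>R H t)"
      by (rule Bochner_Integration.integrable_cong[THEN iffD1, rotated 2])
        (auto simp: indicator_def)
  qed
  also have "\<dots> = (LINT t | ?P. H t)"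
  proof (rule integral_cong_AE)
    have "AE t in ?P. inj_on t {1..n}" by (rule PiM_lborel_AE_inj_on) simp
    then show "AE t in ?P. (\<Sum>\<sigma>\<in>?S. indicator ?E (\<lambda>i\<in>{1..n}. t (\<sigma> i)) *\<^sub>R H t) = H t"
    proof (rule AE_mp, intro AE_I2 impI)
      fix t assume t: "t \<in> space ?P" and "inj_on t {1..n}"
      then obtain \<sigma> where \<sigma>: "\<sigma> permutes {1..n}" "strict_mono_on {1..n} (t \<circ> \<sigma>)"
        and uniq: "\<And>\<tau>. \<tau> permutes {1..n} \<Longrightarrow> strict_mono_on {1..n} (t \<circ> \<tau>) \<Longrightarrow> \<tau> = \<sigma>"
        using ex1_sorting_permutation by (metis (no_types, lifting))
      \<comment> \<open>Only the permutation that sorts t contributes at t.\<close>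
      have "indicator ?E (\<lambda>i\<in>{1..n}. t (\<tau> i)) = (if \<tau> = \<sigma> then 1 else 0 :: real)" if "\<tau> \<in> ?S" for \<tau>
      proof -
        have "strict_mono_on {1..n} (\<lambda>i\<in>{1..n}. t (\<tau> i)) \<longleftrightarrow> strict_mono_on {1..n} (t \<circ> \<tau>)"
          by (auto simp: strict_mono_on_def)
        then have "(\<lambda>i\<in>{1..n}. t (\<tau> i)) \<in> ?E \<longleftrightarrow> strict_mono_on {1..n} (t \<circ> \<tau>)"
          by (simp add: chamber_def space_PiM del: One_nat_def)
        also have "\<dots> \<longleftrightarrow> \<tau> = \<sigma>"
          using \<sigma> uniq that by blast
        finally show ?thesis by (simp add: indicator_def)
      qed
      then have "(\<Sum>\<tau>\<in>?S. indicator ?E (\<lambda>i\<in>{1..n}. t (\<tau> i)) *\<^sub>R H t) =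
          (\<Sum>\<tau>\<in>?S. if \<tau> = \<sigma> then H t else 0)"
        by (intro sum.cong) auto
      also have "\<dots> = H t"
        using \<sigma>(1) by (simp add: finite_permutations)
      finally show "(\<Sum>\<tau>\<in>?S. indicator ?E (\<lambda>i\<in>{1..n}. t (\<tau> i)) *\<^sub>R H t) = H t" .
    qed
    show "H \<in> borel_measurable ?P" using H(1) by auto
    show "(\<lambda>t. \<Sum>\<sigma>\<in>?S. indicator ?E (\<lambda>i\<in>{1..n}. t (\<sigma> i)) *\<^sub>R H t) \<in> borel_measurable ?P"
      using H(1) r by (intro borel_measurable_sum borel_measurable_scaleR
          measurable_compose[OF r borel_measurable_indicator[OF chamber_measurable]]) auto
  qed
  also have "\<dots> = (\<Prod>j=1..n. LINT t : {0<..} | lborel. g j t)"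
    by (rule H(2))
  finally show ?thesis .
qed

section \<open>Cusp forms on the imaginary axis\<close>

definition nome :: "complex \<Rightarrow> complex" where
  "nome z = exp (2 * of_real pi * \<i> * z)"

lemma norm_nome: "norm (nome z) = exp (- 2 * pi * Im z)"
  by (simp add: nome_def norm_exp_eq_Re)

lemma nome_nonzero [simp]: "nome z \<noteq> 0"
  by (simp add: nome_def)

lemma nome_holomorphic [holomorphic_intros]: "nome holomorphic_on S"
  unfolding nome_def by (intro holomorphic_intros)

lemma nome_imaginary: "nome (\<i> * of_real t) = of_real (exp (- 2 * pi * t))"
  by (simp add: nome_def exp_of_real[symmetric] algebra_simps)

lemma nome_add_int: "nome (z + of_int n) = nome z"
proof -
  have "nome (z + of_int n) = nome z * exp ((2 * of_int n * of_real pi) * \<i>)"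
    by (simp add: nome_def exp_add[symmetric] algebra_simps)
  then show ?thesis using exp_integer_2pi[of "of_int n"] by simp
qed

lemma nome_in_unit_disc: "z \<in> upper_half_plane \<Longrightarrow> norm (nome z) < 1"
  by (simp add: norm_nome upper_half_plane_def)

lemma nome_surj:
  assumes "0 < norm q"
  obtains z where "nome z = q" "Im z = - ln (norm q) / (2 * pi)"
proof
  from assms have "q \<noteq> 0" by auto
  let ?z = "Ln q / (2 * of_real pi * \<i>)"
  show "nome ?z = q" using \<open>q \<noteq> 0\<close> by (simp add: nome_def)
  have "?z = - \<i> * Ln q / of_real (2 * pi)" by (simp add: field_simps)
  then have "Im ?z = - Re (Ln q) / (2 * pi)" by (simp only: Im_divide_of_real) simp
  then show "Im ?z = - ln (norm q) / (2 * pi)" using \<open>q \<noteq> 0\<close> by simp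
qed

lemma unit_disc_subset_eball:
  fixes A :: "complex fps"
  assumes "fps_conv_radius A \<ge> 1"
  shows "(ball 0 1 :: complex set) \<subseteq> eball 0 (fps_conv_radius A)"
proof
  fix q :: complex assume "q \<in> ball 0 1"
  then have "ereal (norm q) < 1" by simp
  also note assms
  finally show "q \<in> eball 0 (fps_conv_radius A)" by simp
qed

text \<open>Convergence of the expansion at every real q between 0 and 1 already forces radius at
  least 1. The factor q is split off because the decay at the cusp and, for F, the contraction in
  the maximum principle rest on it.\<close>

lemma cusp_form_fps:
  assumes "f \<in> cusp_forms k"
  obtains A :: "complex fps"
  where "fps_conv_radius A \<ge> 1" "\<And>z. z \<in> upper_half_plane \<Longrightarrow> f z = nome z * eval_fps A (nome z)"
proof -
  obtain a :: "nat \<Rightarrow> complex" where a: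
    "\<And>z. z \<in> upper_half_plane \<Longrightarrow> (\<lambda>r. a r * nome z ^ (r + 1)) sums f z"
    using assms unfolding cusp_forms_def nome_def by blast
  have sums: "(\<lambda>r. a r * nome z ^ r) sums (f z / nome z)" if "z \<in> upper_half_plane" for z
    using sums_divide[OF a[OF that], of "nome z"] by (simp add: field_simps)
  have "conv_radius a \<ge> 1"
  proof (rule conv_radius_geI_ex')
    fix r :: real assume r: "0 < r" "ereal r < 1"
    obtain z where z: "nome z = of_real r" "Im z = - ln (norm (of_real r :: complex)) / (2 * pi)"
      using nome_surj[of "of_real r"] r by auto
    then have "z \<in> upper_half_plane" using r by (simp add: upper_half_plane_def divide_neg_pos)
    from sums[OF this] z show "summable (\<lambda>n. a n * of_real r ^ n)"
      by (simp add: sums_iff)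
  qed
  moreover have "f z = nome z * eval_fps (Abs_fps a) (nome z)" if "z \<in> upper_half_plane" for z
    using sums[OF that] by (simp add: eval_fps_def sums_iff)
  ultimately show ?thesis
    using that[of "Abs_fps a"] by (simp add: fps_conv_radius_def)
qed

text \<open>For t \<ge> 1 the variable q stays in a compact disc inside the unit disc, where the
  power series is bounded; the separate factor q supplies the exponential.\<close>

lemma cusp_form_decay:
  assumes "f \<in> cusp_forms k"
  obtains C where "C \<ge> 0" "\<And>t. t \<ge> 1 \<Longrightarrow> norm (f (\<i> * of_real t)) \<le> C * exp (- 2 * pi * t)"
proof -
  from cusp_form_fps[OF assms] obtain A :: "complex fps" where A: "fps_conv_radius A \<ge> 1"
    and f: "\<And>z. z \<in> upper_half_plane \<Longrightarrow> f z = nome z * eval_fps A (nome z)" by blast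
  let ?K = "cball (0 :: complex) (exp (- 2 * pi))"
  have "norm q < 1" if "q \<in> ?K" for q
  proof -
    have "norm q \<le> exp (- 2 * pi)" using that by simp
    also have "\<dots> < 1" by simp
    finally show ?thesis .
  qed
  then have "?K \<subseteq> eball 0 (fps_conv_radius A)"
    by (intro subset_trans[OF _ unit_disc_subset_eball[OF A]]) auto
  then have "continuous_on ?K (eval_fps A)"
    by (intro continuous_on_subset[OF continuous_on_eval_fps])
  then have "bounded (eval_fps A ` ?K)"
    by (intro compact_imp_bounded compact_continuous_image) auto
  then obtain C where C: "\<And>q. q \<in> ?K \<Longrightarrow> norm (eval_fps A q) \<le> C" "C > 0"
    unfolding bounded_pos by blast
  show ?thesis
  proof
    show "C \<ge> 0" using C by simp
    fix t :: real assume t: "t \<ge> 1"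
    then have "\<i> * of_real t \<in> upper_half_plane" by (simp add: upper_half_plane_def)
    from f[OF this] have "norm (f (\<i> * of_real t)) =
        exp (- 2 * pi * t) * norm (eval_fps A (nome (\<i> * of_real t)))"
      by (simp add: norm_mult norm_nome)
    also have "\<dots> \<le> exp (- 2 * pi * t) * C"
      using t by (intro mult_left_mono C) (auto simp: norm_nome)
    finally show "norm (f (\<i> * of_real t)) \<le> C * exp (- 2 * pi * t)" by (simp add: mult.commute)
  qed
qed

lemma cusp_form_inversion:
  assumes "f \<in> cusp_forms k" "t > 0"
  shows "f (\<i> * of_real (1 / t)) = (\<i> * of_real t) ^ k * f (\<i> * of_real t)"
proof -
  have *: "\<And>a b c d :: int. a * d - b * c = 1 \<Longrightarrow> z \<in> upper_half_plane \<Longrightarrow>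
     f ((of_int a * z + of_int b) / (of_int c * z + of_int d)) = (of_int c * z + of_int d) ^ k * f z" for z
    using assms(1) unfolding cusp_forms_def by blast
  have "\<i> * of_real t \<in> upper_half_plane" using assms by (simp add: upper_half_plane_def)
  \<comment> \<open>The matrix with a = d = 0, b = -1 and c = 1.\<close>
  from *[of 0 0 "-1" 1, OF _ this] have "f (- 1 / (\<i> * of_real t)) = (\<i> * of_real t) ^ k * f (\<i> * of_real t)"
    by simp
  moreover have "- 1 / (\<i> * of_real t) = \<i> * of_real (1 / t)"
    using assms by (simp add: field_simps)
  ultimately show ?thesis by simp
qed

lemma cusp_form_continuous:
  assumes "f \<in> cusp_forms k"
  shows "continuous_on {0<..} (\<lambda>t. f (\<i> * of_real t))"
proof -
  have "continuous_on upper_half_plane f"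
    using assms holomorphic_on_imp_continuous_on unfolding cusp_forms_def by blast
  then show ?thesis
    by (rule continuous_on_compose2) (auto intro!: continuous_intros simp: upper_half_plane_def)
qed

text \<open>The Gamma integral for p! under x = l (t - y). The start y serves the termwise
  integration of tails, y = 0 the domination of the moments at infinity.\<close>

lemma has_bochner_integral_power_exp_shift:
  fixes l y :: real
  assumes "l > 0"
  shows "has_bochner_integral lborel (\<lambda>t. indicator {y..} t * ((t - y) ^ p * exp (- l * t)))
    (exp (- l * y) * fact p / l ^ Suc p)"
proof -
  have "has_bochner_integral lborel (\<lambda>x. indicator {0..} x * (x ^ p * exp (- x))) (fact p :: real)"
  proof (rule has_bochner_integral_nn_integral)
    show "(\<integral>\<^sup>+ x. ennreal (indicator {0..} x * (x ^ p * exp (- x))) \<partial>lborel) = ennreal (fact p)"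
      unfolding nn_intergal_power_times_exp_Ici[of p, simplified, symmetric]
      by (intro nn_integral_cong) (auto split: split_indicator)
  qed (auto simp: indicator_def)
  then have "has_bochner_integral lborel (\<lambda>t. indicator {0..} (- l * y + l * t) *
      ((- l * y + l * t) ^ p * exp (- (- l * y + l * t)))) (fact p / l)"
    using assms lborel_has_bochner_integral_real_affine_iff[of l _ "fact p :: real" "- l * y"]
    by (simp add: divide_inverse mult.commute)
  from has_bochner_integral_mult_right[OF this, of "exp (- l * y) / l ^ p"]
  have "has_bochner_integral lborel (\<lambda>t. exp (- l * y) / l ^ p * (indicator {0..} (- l * y + l * t) *
      ((- l * y + l * t) ^ p * exp (- (- l * y + l * t))))) (exp (- l * y) / l ^ p * (fact p / l))"
    by simp
  moreover have "exp (- l * y) / l ^ p * (indicator {0..} (- l * y + l * t) *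
      ((- l * y + l * t) ^ p * exp (- (- l * y + l * t)))) =
      indicator {y..} t * ((t - y) ^ p * exp (- l * t))" for t
  proof -
    have "- l * y + l * t = l * (t - y)" by (simp add: algebra_simps)
    moreover have "exp (- l * y) * exp (- (l * (t - y))) = exp (- l * t)"
      by (simp add: exp_add[symmetric] algebra_simps)
    ultimately show ?thesis
      using assms by (auto simp: indicator_def power_mult_distrib zero_le_mult_iff)
  qed
  ultimately show ?thesis by (simp add: mult.commute)
qed

lemma power_div_fact_le_exp:
  fixes x :: real
  assumes "x \<ge> 0"
  shows "x ^ k / fact k \<le> exp x"
proof -
  have "(\<Sum>n\<in>{k}. inverse (fact n) * x ^ n) \<le> suminf (\<lambda>n. inverse (fact n) * x ^ n)"
    using assms summable_exp[of x] by (intro sum_le_suminf) auto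
  then show ?thesis by (simp add: exp_def divide_inverse mult.commute)
qed

text \<open>At infinity the exponential decay beats every power of t. At 0 the inversion carries
  this decay over from infinity, so the integrand stays bounded on (0, 1].\<close>

lemma cusp_form_moment_integrable:
  assumes f: "f \<in> cusp_forms k"
  shows "set_integrable lborel {0<..} (\<lambda>t. of_real (t ^ p) * f (\<i> * of_real t))"
proof -
  obtain C where C: "C \<ge> 0" "\<And>t. t \<ge> 1 \<Longrightarrow> norm (f (\<i> * of_real t)) \<le> C * exp (- 2 * pi * t)"
    using cusp_form_decay[OF f] by blast
  define g where "g t = of_real (t ^ p) * f (\<i> * of_real t)" for t :: real
  have "continuous_on {0<..} g"
    unfolding g_def by (intro continuous_intros cusp_form_continuous[OF f])
  then have meas: "set_borel_measurable lborel S g" if "S \<in> sets borel" "S \<subseteq> {0<..}" for S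
    using that unfolding set_borel_measurable_def
    by (auto intro!: borel_measurable_continuous_on_indicator intro: continuous_on_subset)
  have "set_integrable lborel {0<..1} g"
  proof (rule set_integrable_bound)
    \<comment> \<open>Inversion costs a factor t^(-k), while exp (-2 \<pi> / t) \<le> k! t^k by a
      single term of the exponential series; the powers of t cancel.\<close>
    define D where "D = C * fact k"
    show "set_integrable lborel {0<..1::real} (\<lambda>_. D)"
      by (simp add: set_integrable_def)
    show "set_borel_measurable lborel {0<..1} g"
      by (rule meas) auto
    have "norm (g t) \<le> D" if t: "0 < t" "t \<le> 1" for t
    proof -
      have 1: "norm (f (\<i> * of_real (1 / t))) = t ^ k * norm (f (\<i> * of_real t))"
        unfolding cusp_form_inversion[OF f t(1)] using t by (simp add: norm_mult norm_power)
      have 2: "norm (f (\<i> * of_real (1 / t))) \<le> C * exp (- 2 * pi * (1 / t))"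
        using t by (intro C) simp
      have "1 * (1 / t) \<le> 2 * pi * (1 / t)"
        using t pi_gt3 by (intro mult_right_mono) auto
      then have "(1 / t) ^ k / fact k \<le> exp (2 * pi * (1 / t))"
        using t power_div_fact_le_exp[of "1 / t" k]
        by (simp add: order_trans[OF _ iffD2[OF exp_le_cancel_iff]])
      then have 3: "exp (- 2 * pi * (1 / t)) \<le> fact k * t ^ k"
        using t by (simp add: exp_minus field_simps)
      have "t ^ k * norm (f (\<i> * of_real t)) \<le> C * (fact k * t ^ k)"
        using 1 2 mult_left_mono[OF 3 C(1)] by linarith
      then have "norm (f (\<i> * of_real t)) \<le> D"
        using t by (simp add: D_def mult.assoc mult.commute mult.left_commute)
      moreover have "norm (g t) = t ^ p * norm (f (\<i> * of_real t))"
        using t by (simp add: g_def norm_mult norm_power)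
      moreover have "t ^ p \<le> 1" using t by (simp add: power_le_one)
      ultimately show ?thesis
        using t by (smt (verit) mult_left_le_one_le norm_ge_zero zero_le_power)
    qed
    then show "AE t in lborel. t \<in> {0<..1} \<longrightarrow> norm (g t) \<le> norm D"
      by (intro AE_I2) force
  qed
  moreover have "set_integrable lborel {1..} g"
  proof (rule set_integrable_bound)
    have "integrable lborel (\<lambda>t. indicator {0..} t * ((t - 0) ^ p * exp (- (2 * pi) * t)))"
      using has_bochner_integral_power_exp_shift[of "2 * pi" 0 p] pi_gt_zero
      by (simp only: has_bochner_integral_iff)
    then have "set_integrable lborel {0..} (\<lambda>t. t ^ p * exp (- (2 * pi) * t))"
      by (simp add: set_integrable_def)
    then have "set_integrable lborel {1..} (\<lambda>t. t ^ p * exp (- (2 * pi) * t))"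
      by (rule set_integrable_subset) auto
    then show "set_integrable lborel {1..} (\<lambda>t. C * (t ^ p * exp (- (2 * pi) * t)))"
      by (rule set_integrable_mult_right)
    show "set_borel_measurable lborel {1..} g"
      by (rule meas) auto
    have "norm (g t) \<le> C * (t ^ p * exp (- (2 * pi) * t))" if "t \<ge> 1" for t
    proof -
      have "norm (g t) = t ^ p * norm (f (\<i> * of_real t))"
        using that by (simp add: g_def norm_mult norm_power)
      also have "\<dots> \<le> t ^ p * (C * exp (- 2 * pi * t))"
        using that by (intro mult_left_mono C) auto
      finally show ?thesis by (simp add: mult_ac)
    qed
    then show "AE t in lborel. t \<in> {1..} \<longrightarrow> norm (g t) \<le> norm (C * (t ^ p * exp (- (2 * pi) * t)))"
      by (intro AE_I2) force
  qed
  ultimately have "set_integrable lborel ({0<..1} \<union> {1..}) g"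
    by (rule set_integrable_Un) auto
  moreover have "{0<..1} \<union> {1..} = {0::real<..}" by auto
  ultimately show ?thesis unfolding g_def by simp
qed

section \<open>Eichler integrals\<close>

lemma fps_conv_radius_mono:
  fixes A B :: "complex fps"
  assumes "\<And>n. norm (fps_nth B n) \<le> norm (fps_nth A n)"
  shows "fps_conv_radius A \<le> fps_conv_radius B"
  unfolding fps_conv_radius_def
proof (rule conv_radius_geI_ex')
  fix r :: real assume r: "0 < r" "ereal r < conv_radius (fps_nth A)"
  have "summable (\<lambda>n. norm (fps_nth A n * of_real r ^ n))"
    using r by (intro abs_summable_in_conv_radius) simp
  then show "summable (\<lambda>n. fps_nth B n * of_real r ^ n)"
    by (rule summable_comparison_test'[where N = 0])
      (use assms r in \<open>auto simp: norm_mult norm_power intro: mult_right_mono\<close>)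
qed

text \<open>
  Coefficient \<open>r\<close> of \<open>A\<close> belongs to the power \<open>q ^ (r + 1)\<close> of the cusp form \<open>q A(q)\<close>, hence \<open>Suc r\<close>.
\<close>

definition eichler_fps :: "nat \<Rightarrow> complex fps \<Rightarrow> complex fps" where
  "eichler_fps p A = Abs_fps (\<lambda>r. fps_nth A r / of_nat (Suc r) ^ Suc p)"

lemma eichler_fps_conv_radius: "fps_conv_radius A \<le> fps_conv_radius (eichler_fps p A)"
proof (rule fps_conv_radius_mono)
  fix n
  have "1 \<le> real (Suc n) ^ Suc p" by (rule one_le_power) simp
  then have "norm (fps_nth A n) * 1 \<le> norm (fps_nth A n) * real (Suc n) ^ Suc p"
    by (rule mult_left_mono) simp
  then have "norm (fps_nth A n) / real (Suc n) ^ Suc p \<le> norm (fps_nth A n)"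
    by (subst pos_divide_le_eq) auto
  then show "norm (fps_nth (eichler_fps p A) n) \<le> norm (fps_nth A n)"
    by (simp add: eichler_fps_def norm_divide norm_power del: of_nat_Suc power_Suc)
qed

text \<open>Termwise integration of the q-expansion: each term gives a shifted Gamma integral, whose
  denominator (2 \<pi> (r + 1))^(p + 1) splits into the constant in front and the division in
  \<open>eichler_fps\<close>.\<close>

lemma eichler_integral:
  assumes A: "fps_conv_radius A \<ge> 1"
    and f: "\<And>z. z \<in> upper_half_plane \<Longrightarrow> f z = nome z * eval_fps A (nome z)"
    and y: "y > 0"
  shows "(LINT t:{y..}|lborel. of_real ((t - y) ^ p) * f (\<i> * of_real t)) =
    of_real (fact p / (2 * pi) ^ Suc p) *
      (nome (\<i> * of_real y) * eval_fps (eichler_fps p A) (nome (\<i> * of_real y)))"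
proof -
  \<comment> \<open>Decay rate along the imaginary axis of the term with q^(r + 1).\<close>
  define l where "l r = 2 * pi * real (Suc r)" for r
  have l: "l r > 0" for r by (simp add: l_def)
  define u where "u r t = indicator {y..} t * ((t - y) ^ p * exp (- l r * t))" for r t
  define c where "c r = exp (- l r * y) * fact p / l r ^ Suc p" for r
  define v where "v r t = complex_of_real (u r t) * fps_nth A r" for r t
  have u: "has_bochner_integral lborel (u r) (c r)" for r
    unfolding u_def c_def by (rule has_bochner_integral_power_exp_shift[OF l])
  have u_nonneg: "u r t \<ge> 0" for r t
    by (auto simp: u_def indicator_def)
  have v: "has_bochner_integral lborel (v r) (of_real (c r) * fps_nth A r)" for r
    unfolding v_def by (intro has_bochner_integral_mult_left has_bochner_integral_of_real u)
  have nv: "has_bochner_integral lborel (\<lambda>t. norm (v r t)) (c r * norm (fps_nth A r))" for r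
    using has_bochner_integral_mult_left[OF u[of r], where c = "norm (fps_nth A r)"] u_nonneg
    by (simp add: v_def norm_mult)
  have nome_r: "nome (\<i> * of_real t) ^ Suc r = of_real (exp (- l r * t))" for r t
  proof -
    have "exp (- 2 * pi * t) ^ Suc r = exp (- l r * t)"
      unfolding exp_of_nat_mult[symmetric] by (simp add: l_def algebra_simps)
    then show ?thesis unfolding nome_imaginary of_real_power[symmetric] by simp
  qed
  have radius: "ereal (norm (nome (\<i> * of_real t))) < fps_conv_radius A" if "t > 0" for t
  proof -
    have "nome (\<i> * of_real t) \<in> ball 0 1"
      using that nome_in_unit_disc[of "\<i> * of_real t"] by (simp add: upper_half_plane_def)
    then show ?thesis using unit_disc_subset_eball[OF A] by auto
  qed
  have sum_f: "(\<lambda>r. of_real (exp (- l r * t)) * fps_nth A r) sums f (\<i> * of_real t)" if "t > 0" for t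
  proof -
    have "(\<lambda>r. nome (\<i> * of_real t) * (fps_nth A r * nome (\<i> * of_real t) ^ r)) sums
        (nome (\<i> * of_real t) * eval_fps A (nome (\<i> * of_real t)))"
      by (intro sums_mult sums_eval_fps radius that)
    moreover have "nome (\<i> * of_real t) * (fps_nth A r * nome (\<i> * of_real t) ^ r) =
        of_real (exp (- l r * t)) * fps_nth A r" for r
      unfolding nome_r[symmetric] by simp
    moreover have "nome (\<i> * of_real t) * eval_fps A (nome (\<i> * of_real t)) = f (\<i> * of_real t)"
      using that f[of "\<i> * of_real t"] by (simp add: upper_half_plane_def)
    ultimately show ?thesis by simp
  qed
  have abs_sum: "summable (\<lambda>r. exp (- l r * t) * norm (fps_nth A r))" if "t > 0" for t
  proof -
    have "summable (\<lambda>r. norm (nome (\<i> * of_real t)) * norm (fps_nth A r * nome (\<i> * of_real t) ^ r))"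
      by (intro summable_mult norm_summable_fps radius that)
    moreover have "norm (nome (\<i> * of_real t)) * norm (fps_nth A r * nome (\<i> * of_real t) ^ r) =
        exp (- l r * t) * norm (fps_nth A r)" for r
    proof -
      have "norm (nome (\<i> * of_real t)) * norm (fps_nth A r * nome (\<i> * of_real t) ^ r) =
          norm (nome (\<i> * of_real t) ^ Suc r) * norm (fps_nth A r)"
        by (simp add: norm_mult norm_power)
      then show ?thesis unfolding nome_r by simp
    qed
    ultimately show ?thesis by simp
  qed
  have c_eq: "c r = fact p / (2 * pi) ^ Suc p * (exp (- l r * y) / real (Suc r) ^ Suc p)" for r
    by (simp add: c_def l_def power_mult_distrib mult.commute del: of_nat_Suc power_Suc)
  have "(\<integral>t. suminf (\<lambda>r. v r t) \<partial>lborel) = suminf (\<lambda>r. integral\<^sup>L lborel (v r))"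
  proof (rule integral_suminf)
    show "integrable lborel (v r)" for r using v by (simp add: has_bochner_integral_iff)
    have "summable (\<lambda>r. norm (v r t))" for t
    proof (cases "t \<ge> y")
      case True
      have "summable (\<lambda>r. (t - y) ^ p * (exp (- l r * t) * norm (fps_nth A r)))"
        using True y by (intro summable_mult abs_sum) auto
      then show ?thesis
        using True by (simp add: v_def u_def norm_mult norm_power mult.assoc)
    qed (simp add: v_def u_def)
    then show "AE t in lborel. summable (\<lambda>r. norm (v r t))" by simp
    \<comment> \<open>Dropping the denominators, which are at least 1, leaves a multiple of the
      absolutely convergent q-expansion at the point iy.\<close>
    have "summable (\<lambda>r. c r * norm (fps_nth A r))"
    proof (rule summable_comparison_test'[where N = 0])
      show "summable (\<lambda>r. fact p / (2 * pi) ^ Suc p * (exp (- l r * y) * norm (fps_nth A r)))"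
        by (intro summable_mult abs_sum y)
      fix r :: nat
      have "1 \<le> real (Suc r) ^ Suc p" by (rule one_le_power) simp
      then have "exp (- l r * y) / real (Suc r) ^ Suc p \<le> exp (- l r * y) / 1"
        by (intro divide_left_mono) auto
      then have "c r \<le> fact p / (2 * pi) ^ Suc p * exp (- l r * y)"
        unfolding c_eq by (intro mult_left_mono) auto
      moreover have "c r \<ge> 0" using l[of r] by (simp add: c_def)
      ultimately show "norm (c r * norm (fps_nth A r)) \<le>
          fact p / (2 * pi) ^ Suc p * (exp (- l r * y) * norm (fps_nth A r))"
        by (simp only: mult.assoc[symmetric] real_norm_def abs_mult abs_norm_cancel abs_of_nonneg)
          (rule mult_right_mono, auto)
    qed
    then show "summable (\<lambda>r. \<integral>t. norm (v r t) \<partial>lborel)"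
      using nv by (simp add: has_bochner_integral_iff)
  qed
  also have "(\<lambda>t. suminf (\<lambda>r. v r t)) = (\<lambda>t. indicator {y..} t *\<^sub>R (of_real ((t - y) ^ p) * f (\<i> * of_real t)))"
  proof
    fix t
    show "suminf (\<lambda>r. v r t) = indicator {y..} t *\<^sub>R (of_real ((t - y) ^ p) * f (\<i> * of_real t))"
    proof (cases "t \<ge> y")
      case True
      have "(\<lambda>r. of_real ((t - y) ^ p) * (of_real (exp (- l r * t)) * fps_nth A r)) sums
          (of_real ((t - y) ^ p) * f (\<i> * of_real t))"
        using True y by (intro sums_mult sum_f) auto
      then show ?thesis
        using True by (simp add: v_def u_def sums_iff mult.assoc)
    qed (simp add: v_def u_def)
  qed
  also have "(\<lambda>r. integral\<^sup>L lborel (v r)) = (\<lambda>r. of_real (c r) * fps_nth A r)"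
    using v by (simp add: has_bochner_integral_iff)
  also have "(\<lambda>r. of_real (c r) * fps_nth A r) = (\<lambda>r. of_real (fact p / (2 * pi) ^ Suc p) *
      (nome (\<i> * of_real y) * (fps_nth (eichler_fps p A) r * nome (\<i> * of_real y) ^ r)))"
  proof
    fix r
    have "of_real (c r) * fps_nth A r = of_real (fact p / (2 * pi) ^ Suc p) *
        (of_real (exp (- l r * y)) * fps_nth (eichler_fps p A) r)"
      unfolding c_eq by (simp add: eichler_fps_def)
    then show "of_real (c r) * fps_nth A r = of_real (fact p / (2 * pi) ^ Suc p) *
      (nome (\<i> * of_real y) * (fps_nth (eichler_fps p A) r * nome (\<i> * of_real y) ^ r))"
      unfolding nome_r[symmetric] by (simp add: mult_ac)
  qed
  also have "suminf (\<lambda>r. of_real (fact p / (2 * pi) ^ Suc p) *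
      (nome (\<i> * of_real y) * (fps_nth (eichler_fps p A) r * nome (\<i> * of_real y) ^ r))) =
      of_real (fact p / (2 * pi) ^ Suc p) *
      (nome (\<i> * of_real y) * eval_fps (eichler_fps p A) (nome (\<i> * of_real y)))"
    using radius[OF y] eichler_fps_conv_radius[of A p]
    by (intro sums_unique[symmetric] sums_mult sums_eval_fps) (auto intro: less_le_trans)
  finally show ?thesis unfolding set_lebesgue_integral_def .
qed

text \<open>Bridge to the notion of integrability in which the substitution t = 1 / u is carried
  out.\<close>

lemma set_integrable_lborel_imp_absolutely_integrable:
  fixes f :: "real \<Rightarrow> complex"
  assumes "set_integrable lborel S f"
  shows "f absolutely_integrable_on S"
  using assms unfolding set_integrable_def by (simp add: integrable_completion)

text \<open>The power (t - x)^(k - 2) expands into moments of order at most k - 2, so the integral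
  over the whole half line vanishes for every x. The tail from y is thus minus the integral over (0,
  y], and t = 1 / u identifies the latter with the tail from 1 / y up to a constant.\<close>

lemma tail_integral_inversion:
  assumes f: "f \<in> cusp_forms k" and k: "even k" "k > 0"
    and zero: "\<And>p. p \<le> k - 2 \<Longrightarrow> (LINT t:{0<..}|lborel. of_real (t ^ p) * f (\<i> * of_real t)) = 0"
    and y: "y > 0"
  defines "I \<equiv> \<lambda>y. LINT t:{y..}|lborel. of_real ((t - y) ^ (k - 2)) * f (\<i> * of_real t)"
  shows "I (1 / y) * (\<i> * of_real y) ^ (k - 2) = I y"
proof -
  define w where "w = k - 2"
  have w: "even w" "k = w + 2" using k by (auto simp: w_def elim!: evenE)
  define \<psi> where "\<psi> x t = of_real ((t - x) ^ w) * f (\<i> * of_real t)" for x t :: real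
  have \<psi>_expand: "\<psi> x t = (\<Sum>p\<le>w. of_real (of_nat (w choose p) * (- x) ^ (w - p)) * (of_real (t ^ p) * f (\<i> * of_real t)))" for x t
  proof -
    have "(t - x) ^ w = (\<Sum>p\<le>w. of_nat (w choose p) * t ^ p * (- x) ^ (w - p))"
      using binomial_ring[of t "- x" w] by simp
    then show ?thesis by (simp add: \<psi>_def sum_distrib_left mult_ac)
  qed
  have moment: "set_integrable lborel {0<..} (\<lambda>t. of_real (of_nat (w choose p) * (- x) ^ (w - p)) * (of_real (t ^ p) * f (\<i> * of_real t)))" for x :: real and p
    by (intro set_integrable_mult_right cusp_form_moment_integrable[OF f])
  have int: "set_integrable lborel {0<..} (\<psi> x)" for x
    unfolding set_integrable_def \<psi>_expand scaleR_sum_right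
    by (intro Bochner_Integration.integrable_sum moment[unfolded set_integrable_def])
  have "(LINT t:{0<..}|lborel. \<psi> x t) = 0" for x
  proof -
    have "(LINT t:{0<..}|lborel. \<psi> x t) = (\<Sum>p\<le>w. LINT t:{0<..}|lborel. of_real (of_nat (w choose p) * (- x) ^ (w - p)) * (of_real (t ^ p) * f (\<i> * of_real t)))"
      unfolding set_lebesgue_integral_def \<psi>_expand scaleR_sum_right
      by (intro Bochner_Integration.integral_sum moment[unfolded set_integrable_def])
    then show ?thesis using zero by (simp add: w_def set_integral_mult_right)
  qed
  then have full: "integral {0<..} (\<psi> y) = 0"
    using set_borel_integral_eq_integral[OF int, of y] by simp
  have sub: "set_integrable lborel S (\<psi> x)" if "S \<subseteq> {0<..}" "S \<in> sets borel" for S x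
    using int[of x] that by (rule_tac set_integrable_subset) auto
  have I: "I x = integral {x..} (\<psi> x)" if "x > 0" for x
    unfolding I_def w_def[symmetric] \<psi>_def[symmetric]
    using that by (intro set_borel_integral_eq_integral(2) sub) auto
  have int1: "\<psi> y absolutely_integrable_on {0<..y}" "\<psi> y absolutely_integrable_on {y..}"
    using y by (auto intro!: set_integrable_lborel_imp_absolutely_integrable sub)
  have "integral ({0<..y} \<union> {y..}) (\<psi> y) = integral {0<..y} (\<psi> y) + integral {y..} (\<psi> y)"
  proof (rule integral_Un)
    have "{0<..y} \<inter> {y..} \<subseteq> {y}" by auto
    then show "negligible ({0<..y} \<inter> {y..})" by (rule negligible_subset[rotated]) simp
  qed (use int1 in \<open>auto intro: set_lebesgue_integral_eq_integral(1)\<close>)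
  moreover have "{0<..y} \<union> {y..} = {0<..}" using y by auto
  ultimately have split: "integral {0<..y} (\<psi> y) = - integral {y..} (\<psi> y)"
    using full by (simp add: eq_neg_iff_add_eq_0)
  \<comment> \<open>The factor i^k comes from modularity and y^(-w) from (1/u - 1/y)^w; the powers
    of u from the Jacobian, this binomial and modularity cancel, since k = w + 2.\<close>
  define C where "C = \<i> ^ k * of_real (1 / y ^ w)"
  have image: "(\<lambda>u. 1 / u) ` {0<..y} = {1 / y..}"
  proof (intro equalityI subsetI)
    fix t assume "t \<in> {1 / y..}"
    then have "1 / y \<le> t" by simp
    moreover have "0 < 1 / y" using y by simp
    ultimately have "t > 0" by (rule less_le_trans[rotated])
    with y \<open>1 / y \<le> t\<close> have "1 / t \<in> {0<..y}" by (simp add: field_simps)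
    then show "t \<in> (\<lambda>u. 1 / u) ` {0<..y}" by (rule rev_image_eqI) simp
  next
    fix t assume "t \<in> (\<lambda>u. 1 / u) ` {0<..y}"
    then show "t \<in> {1 / y..}" using y by (auto intro!: divide_left_mono)
  qed
  have "(\<lambda>u. \<bar>- 1 / u\<^sup>2\<bar> *\<^sub>R \<psi> (1 / y) (1 / u)) absolutely_integrable_on {0<..y} \<and>
      integral {0<..y} (\<lambda>u. \<bar>- 1 / u\<^sup>2\<bar> *\<^sub>R \<psi> (1 / y) (1 / u)) = I (1 / y)"
  proof (subst has_absolute_integral_change_of_variables_real)
    show "((\<lambda>u. 1 / u) has_field_derivative - 1 / u\<^sup>2) (at u within {0<..y})" if "u \<in> {0<..y}" for u
      using that by (auto intro!: derivative_eq_intros simp: power2_eq_square)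
    show "inj_on (\<lambda>u. 1 / u) {0<..y}" by (auto simp: inj_on_def)
    show "\<psi> (1 / y) absolutely_integrable_on (\<lambda>u. 1 / u) ` {0<..y} \<and>
        integral ((\<lambda>u. 1 / u) ` {0<..y}) (\<psi> (1 / y)) = I (1 / y)"
      unfolding image using y I[of "1 / y"]
      by (auto intro!: set_integrable_lborel_imp_absolutely_integrable sub)
        (auto intro: less_le_trans[of 0 "1 / y"])
  qed auto
  then have "I (1 / y) = integral {0<..y} (\<lambda>u. \<bar>- 1 / u\<^sup>2\<bar> *\<^sub>R \<psi> (1 / y) (1 / u))" by simp
  also have "\<dots> = integral {0<..y} (\<lambda>u. C * \<psi> y u)"
  proof (rule integral_cong)
    fix u assume "u \<in> {0<..y}"
    then have u: "u > 0" by simp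
    \<comment> \<open>The difference reappears with reversed sign, which the even exponent w
      removes.\<close>
    have "(1 / u - 1 / y) ^ w = ((y - u) / (u * y)) ^ w"
      using u y by (simp add: field_simps)
    also have "\<dots> = (u - y) ^ w / (u ^ w * y ^ w)"
      using power_minus_even[OF w(1), of "u - y"] by (simp add: power_divide power_mult_distrib)
    finally have 1: "(1 / u - 1 / y) ^ w = (u - y) ^ w / (u ^ w * y ^ w)" .
    have 2: "f (\<i> * of_real (1 / u)) = \<i> ^ k * of_real (u ^ k) * f (\<i> * of_real u)"
      using cusp_form_inversion[OF f u] by (simp add: power_mult_distrib)
    have "\<bar>- 1 / u\<^sup>2\<bar> = 1 / u\<^sup>2" using u by simp
    then have "\<bar>- 1 / u\<^sup>2\<bar> *\<^sub>R \<psi> (1 / y) (1 / u) =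
      of_real (1 / u\<^sup>2 * ((u - y) ^ w / (u ^ w * y ^ w)) * u ^ k) * (\<i> ^ k * f (\<i> * of_real u))"
      unfolding \<psi>_def 1 2 scaleR_conv_of_real of_real_mult by (simp add: mult_ac)
    also have "1 / u\<^sup>2 * ((u - y) ^ w / (u ^ w * y ^ w)) * u ^ k = 1 / y ^ w * (u - y) ^ w"
      using u y by (simp add: w(2) power_add power2_eq_square field_simps)
    finally show "\<bar>- 1 / u\<^sup>2\<bar> *\<^sub>R \<psi> (1 / y) (1 / u) = C * \<psi> y u"
      by (simp add: C_def \<psi>_def mult_ac)
  qed
  also have "\<dots> = C * integral {0<..y} (\<psi> y)" by simp
  also have "\<dots> = - C * I y" using split I[OF y] by simp
  finally have "I (1 / y) * (\<i> * of_real y) ^ w = - (\<i> ^ k * \<i> ^ w) * I y"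
    using y by (simp add: C_def power_mult_distrib)
  \<comment> \<open>k + w is twice the odd number w + 1. This sign compensates the one from
    splitting the vanishing integral.\<close>
  also have "\<i> ^ k * \<i> ^ w = (-1 :: complex)"
  proof -
    have "\<i> ^ k * \<i> ^ w = (\<i> ^ 2) ^ (w + 1)"
      unfolding power_mult[symmetric] power_add[symmetric] w(2) by (rule arg_cong[where f = "\<lambda>n. \<i> ^ n"]) simp
    then show ?thesis using w(1) by simp
  qed
  finally show ?thesis by (simp add: w_def)
qed

section \<open>Cusp forms of nonpositive weight\<close>

text \<open>Below height 1/2, a translation to \<open>\<bar>Re w\<bar> \<le> 1 / 2\<close> makes the
  squared norm at most 1/2, so inversion at least doubles the height. Asking for 1/2 rather than the
  sharp bound for the fundamental domain keeps this doubling uniform.\<close>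

lemma upper_half_plane_vertical_reduction:
  fixes \<phi> :: "complex \<Rightarrow> real"
  assumes translation: "\<And>z n. z \<in> upper_half_plane \<Longrightarrow> \<phi> (z + of_int n) = \<phi> z"
    and inversion: "\<And>z. z \<in> upper_half_plane \<Longrightarrow> \<phi> (- 1 / z) = \<phi> z"
    and z: "z \<in> upper_half_plane"
  shows "\<exists>z'. Im z' \<ge> 1 / 2 \<and> \<phi> z' = \<phi> z"
proof -
  \<comment> \<open>N bounds the number of doublings that are still needed.\<close>
  have "\<exists>z'. Im z' \<ge> 1 / 2 \<and> \<phi> z' = \<phi> z" if "z \<in> upper_half_plane" "Im z * 2 ^ N \<ge> 1 / 2" for N z
    using that
  proof (induction N arbitrary: z)
    case 0
    then show ?case by auto
  next
    case (Suc N)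
    show ?case
    proof (cases "Im z \<ge> 1 / 2")
      case True
      then show ?thesis by blast
    next
      case False
      define w where "w = z + of_int (- round (Re z))"
      have w: "w \<in> upper_half_plane" "Im w = Im z" "\<bar>Re w\<bar> \<le> 1 / 2"
        using Suc.prems(1) of_int_round_abs_le[of "Re z"]
        by (auto simp: w_def upper_half_plane_def abs_minus_commute)
      have pos: "Im w > 0" using w(1) by (simp add: upper_half_plane_def)
      have "(Re w)\<^sup>2 \<le> (1 / 2)\<^sup>2" using w(3) by (subst abs_le_square_iff[symmetric]) simp
      moreover have "(Im w)\<^sup>2 \<le> (1 / 2)\<^sup>2"
        using False w(2) pos by (intro power_mono) auto
      ultimately have norm: "(Re w)\<^sup>2 + (Im w)\<^sup>2 \<le> 1 / 2"
        by (simp add: power2_eq_square)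
      have norm_pos: "(Re w)\<^sup>2 + (Im w)\<^sup>2 > 0" using pos by (simp add: add_nonneg_pos)
      have Im: "Im (- 1 / w) = Im w / ((Re w)\<^sup>2 + (Im w)\<^sup>2)"
        by (simp add: Im_divide)
      have "Im w / (1 / 2) \<le> Im (- 1 / w)"
        unfolding Im using norm norm_pos pos by (intro divide_left_mono) auto
      then have ge: "2 * Im w \<le> Im (- 1 / w)" by simp
      then have "- 1 / w \<in> upper_half_plane" using pos by (simp add: upper_half_plane_def)
      moreover have "1 / 2 \<le> Im (- 1 / w) * 2 ^ N"
      proof -
        have "1 / 2 \<le> 2 * Im w * 2 ^ N" using Suc.prems(2) w(2) by simp
        also have "\<dots> \<le> Im (- 1 / w) * 2 ^ N" using ge by (intro mult_right_mono) auto
        finally show ?thesis .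
      qed
      ultimately obtain z' where "Im z' \<ge> 1 / 2" "\<phi> z' = \<phi> (- 1 / w)"
        using Suc.IH by blast
      then show ?thesis
        using inversion[OF w(1)] translation[OF Suc.prems(1)] unfolding w_def by metis
    qed
  qed
  moreover obtain N where "1 / 2 / Im z < 2 ^ N"
    using real_arch_pow[of 2 "1 / 2 / Im z"] by auto
  then have "Im z * 2 ^ N \<ge> 1 / 2"
    using z by (simp add: upper_half_plane_def field_simps)
  ultimately show ?thesis using z by blast
qed

text \<open>For weight - 2 v the function \<open>\<phi>\<close> is invariant, so a bound on
  \<open>Im z \<ge> 1 / 2\<close> holds on the whole half plane. The maximum principle in the q-disc
  then improves the bound by the factor \<open>\<rho>\<close> < 1, and iteration leaves only
  0.\<close>

lemma nonpositive_weight_cusp_form_zero: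
  assumes B: "fps_conv_radius B \<ge> 1"
  defines "F \<equiv> \<lambda>z. nome z * eval_fps B (nome z)"
  assumes inv: "\<And>z. z \<in> upper_half_plane \<Longrightarrow> F (- 1 / z) * z ^ (2 * v) = F z"
  shows "B = 0"
proof -
  define \<phi> where "\<phi> z = norm (F z) / Im z ^ v" for z
  have \<phi>_nonneg: "\<phi> z \<ge> 0" if "z \<in> upper_half_plane" for z
    using that by (simp add: \<phi>_def upper_half_plane_def)
  have translation: "\<phi> (z + of_int n) = \<phi> z" for z n
    by (simp add: \<phi>_def F_def nome_add_int)
  have inversion: "\<phi> (- 1 / z) = \<phi> z" if z: "z \<in> upper_half_plane" for z
  proof -
    have pos: "Im z > 0" "norm z > 0" using z by (auto simp: upper_half_plane_def)
    have "Im (- 1 / z) = Im z / (norm z)\<^sup>2"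
      by (simp add: Im_divide cmod_power2)
    then have "\<phi> (- 1 / z) = norm (F (- 1 / z)) * norm z ^ (2 * v) / Im z ^ v"
      by (simp add: \<phi>_def power_divide power_mult)
    also have "norm (F (- 1 / z)) * norm z ^ (2 * v) = norm (F z)"
      unfolding inv[OF z, symmetric] by (simp add: norm_mult norm_power)
    finally show ?thesis by (simp add: \<phi>_def)
  qed
  \<comment> \<open>\<open>\<rho>\<close> is the norm of q at height 1/4, and its square the norm at
    height 1/2.\<close>
  define \<rho> where "\<rho> = exp (- pi / 2)"
  have \<rho>: "0 < \<rho>" "\<rho> < 1" by (auto simp: \<rho>_def)
  have ball: "cball 0 \<rho> \<subseteq> (ball 0 1 :: complex set)" using \<rho> by auto
  note holo = holomorphic_on_eval_fps[OF unit_disc_subset_eball[OF B]]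
  have cont: "continuous_on (cball 0 \<rho>) (eval_fps B)"
    using holomorphic_on_imp_continuous_on[OF holo] ball by (rule continuous_on_subset)
  have norm_nome_le: "norm (nome z) \<le> \<rho>\<^sup>2" if "Im z \<ge> 1 / 2" for z
  proof -
    have "2 * pi * Im z \<ge> 2 * pi * (1 / 2)" using that by (intro mult_left_mono) auto
    then show ?thesis by (simp add: norm_nome \<rho>_def flip: exp_double)
  qed
  have \<rho>2: "\<rho>\<^sup>2 \<le> \<rho>" using \<rho> by (simp add: power2_eq_square)
  have bound: "\<phi> z \<le> \<rho>\<^sup>2 * C / (1 / 2) ^ v"
    if C: "\<And>q. q \<in> cball 0 \<rho> \<Longrightarrow> norm (eval_fps B q) \<le> C" and z: "Im z \<ge> 1 / 2" for C z
  proof -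
    have "norm (eval_fps B (nome z)) \<le> C"
      using norm_nome_le[OF z] \<rho>2 by (intro C) simp
    then have "norm (F z) \<le> \<rho>\<^sup>2 * C"
      unfolding F_def norm_mult using norm_nome_le[OF z] by (intro mult_mono) auto
    moreover have "(1 / 2) ^ v \<le> Im z ^ v" using z by (intro power_mono) auto
    moreover have "C \<ge> 0" using order_trans[OF norm_ge_zero C[of 0]] \<rho> by simp
    ultimately show ?thesis
      unfolding \<phi>_def by (intro frac_le) auto
  qed
  \<comment> \<open>Maximum principle on \<open>Im z \<ge> 1 / 4\<close>, i.e. \<open>norm q \<le> \<rho>\<close>: one factor \<open>q\<close> of \<open>F\<close> is left over and gains \<open>\<rho>\<close>.\<close>
  have contraction: "\<phi> z \<le> M * \<rho>"
    if M: "\<And>z. Im z \<ge> 1 / 2 \<Longrightarrow> \<phi> z \<le> M" and z: "Im z \<ge> 1 / 2" for M z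
  proof -
    have M_all: "\<phi> z \<le> M" if zu: "z \<in> upper_half_plane" for z
    proof -
      obtain z' where "Im z' \<ge> 1 / 2" "\<phi> z' = \<phi> z"
        using upper_half_plane_vertical_reduction[of \<phi> z, OF _ inversion zu] translation by auto
      then show ?thesis using M[of z'] by simp
    qed
    have "M \<ge> 0"
      using M[OF z] \<phi>_nonneg[of z] z by (auto simp: upper_half_plane_def)
    have "norm (eval_fps B q) \<le> M * (1 / 4) ^ v / \<rho>" if "q \<in> cball 0 \<rho>" for q
    proof (rule maximum_modulus_frontier[OF _ _ _ _ that])
      show "eval_fps B holomorphic_on interior (cball 0 \<rho>)"
        using ball interior_subset by (intro holomorphic_on_subset[OF holo]) blast
      show "continuous_on (closure (cball 0 \<rho>)) (eval_fps B)" using cont by simp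
      fix q :: complex assume "q \<in> frontier (cball 0 \<rho>)"
      then have q: "norm q = \<rho>" by (simp add: frontier_cball)
      then obtain x where x: "nome x = q" "Im x = - ln (norm q) / (2 * pi)"
        using nome_surj[of q] \<rho> by auto
      then have "Im x = 1 / 4" using q by (simp add: \<rho>_def)
      with M_all[of x] have "norm (F x) \<le> M * (1 / 4) ^ v"
        by (simp add: \<phi>_def upper_half_plane_def divide_le_eq power_divide field_simps)
      then show "norm (eval_fps B q) \<le> M * (1 / 4) ^ v / \<rho>"
        using \<rho> x q by (simp add: F_def norm_mult field_simps)
    qed simp
    from bound[OF this z] have "\<phi> z \<le> \<rho>\<^sup>2 * (M * (1 / 4) ^ v / \<rho>) / (1 / 2) ^ v" .
    \<comment> \<open>The heights contribute (1/4)^v on the circle and (1/2)^v in the denominator;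
      the quotient is at most 1 because the weight is not positive.\<close>
    also have "\<dots> = M * \<rho> * (1 / 2) ^ v"
      using \<rho> power_mult_distrib[of "1/2 :: real" "1/2" v] by (simp add: power2_eq_square field_simps)
    also have "\<dots> \<le> M * \<rho> * 1"
      using \<open>M \<ge> 0\<close> \<rho> by (intro mult_left_mono power_le_one) auto
    finally show ?thesis by simp
  qed
  have "bounded (eval_fps B ` cball 0 \<rho>)"
    by (intro compact_imp_bounded compact_continuous_image cont) auto
  then obtain C where C: "\<And>q. q \<in> cball 0 \<rho> \<Longrightarrow> norm (eval_fps B q) \<le> C"
    unfolding bounded_iff by blast
  define M0 where "M0 = \<rho>\<^sup>2 * C / (1 / 2) ^ v"
  have geometric: "\<phi> z \<le> M0 * \<rho> ^ N" if "Im z \<ge> 1 / 2" for z N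
    using that
  proof (induction N arbitrary: z)
    case 0
    then show ?case using bound[OF C] by (simp add: M0_def)
  next
    case (Suc N)
    from contraction[OF Suc.IH Suc.prems] show ?case by (simp add: mult_ac)
  qed
  have F_zero: "F z = 0" if z: "Im z \<ge> 1 / 2" for z
  proof -
    have "(\<lambda>N. M0 * \<rho> ^ N) \<longlonglongrightarrow> M0 * 0"
      using \<rho> by (intro tendsto_mult_left LIMSEQ_power_zero) auto
    then have "\<phi> z \<le> 0"
      using geometric[OF z] by (intro LIMSEQ_le_const[where X = "\<lambda>N. M0 * \<rho> ^ N"]) auto
    moreover have "Im z ^ v > 0" using z by simp
    ultimately show ?thesis by (simp add: \<phi>_def divide_le_0_iff)
  qed
  \<comment> \<open>F vanishes for \<open>Im z \<ge> 1 / 2\<close>, which covers the punctured disc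
    of radius \<open>\<rho>\<^sup>2\<close>; at its centre the factor q gives the value 0.\<close>
  have "fps_X * B = 0"
  proof (rule eval_fps_eqD)
    show "0 < fps_conv_radius (fps_X * B)"
      using B fps_conv_radius_mult[of fps_X B] by (auto intro: less_le_trans[of 0 1])
    show "0 < fps_conv_radius (0 :: complex fps)" by simp
    have "eventually (\<lambda>q. q \<in> ball 0 (\<rho>\<^sup>2)) (nhds (0 :: complex))"
      using \<rho> by (intro eventually_nhds_in_open) auto
    then show "eventually (\<lambda>q. eval_fps (fps_X * B) q = eval_fps 0 q) (nhds 0)"
    proof (rule eventually_mono)
      fix q :: complex assume q: "q \<in> ball 0 (\<rho>\<^sup>2)"
      then have "q \<in> ball 0 1" using \<rho>2 \<rho> by auto
      then have "ereal (norm q) < fps_conv_radius B"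
        using unit_disc_subset_eball[OF B] by auto
      then have "eval_fps (fps_X * B) q = q * eval_fps B q"
        by (subst eval_fps_mult) auto
      also have "\<dots> = 0"
      proof (cases "q = 0")
        case False
        then obtain z where z: "nome z = q" "Im z = - ln (norm q) / (2 * pi)"
          using nome_surj[of q] by auto
        have "ln (norm q) < ln (\<rho>\<^sup>2)" using q False by (subst ln_less_cancel_iff) auto
        also have "ln (\<rho>\<^sup>2) = - pi" by (simp add: \<rho>_def ln_realpow)
        finally have "pi / (2 * pi) \<le> - ln (norm q) / (2 * pi)"
          by (intro divide_right_mono) auto
        then have "Im z \<ge> 1 / 2" using z(2) by simp
        from F_zero[OF this] show ?thesis by (simp add: F_def z(1))
      qed simp
      finally show "eval_fps (fps_X * B) q = eval_fps 0 q" by simp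
    qed
  qed
  then show ?thesis by simp
qed

text \<open>Nothing is lost in passing to F: the coefficients of its q-series are those of f divided
  by nonzero integers, so it suffices to show that F vanishes.\<close>

lemma cusp_form_moments_separate:
  assumes f: "f \<in> cusp_forms k" and k: "even k" "k > 0"
    and zero: "\<And>p. p \<le> k - 2 \<Longrightarrow> (LINT t:{0<..}|lborel. of_real (t ^ p) * f (\<i> * of_real t)) = 0"
  shows "f = (\<lambda>_. 0)"
proof -
  obtain A where A: "fps_conv_radius A \<ge> 1"
    and fA: "\<And>z. z \<in> upper_half_plane \<Longrightarrow> f z = nome z * eval_fps A (nome z)"
    using cusp_form_fps[OF f] by blast
  define w where "w = k - 2"
  have "even w" using k by (simp add: w_def)
  then obtain v where v: "w = 2 * v" by (rule evenE)
  define B where "B = eichler_fps w A"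
  have B: "fps_conv_radius B \<ge> 1"
    using A eichler_fps_conv_radius[of A w] by (simp add: B_def)
  define F where "F z = nome z * eval_fps B (nome z)" for z
  define K where "K = complex_of_real (fact w / (2 * pi) ^ Suc w)"
  have "K \<noteq> 0" by (simp add: K_def)
  have open_uhp: "open upper_half_plane" and conn: "connected upper_half_plane"
    unfolding upper_half_plane_def
    by (auto intro: open_halfspace_Im_gt convex_connected convex_halfspace_Im_gt)
  have inv_uhp: "- 1 / z \<in> upper_half_plane" if "z \<in> upper_half_plane" for z
    using that by (auto simp: upper_half_plane_def Im_divide add_nonneg_pos intro!: divide_pos_pos)
  have B_holo: "(\<lambda>z. eval_fps B (nome z)) holomorphic_on upper_half_plane"
    using nome_in_unit_disc
    by (intro holomorphic_on_compose_gen[OF nome_holomorphic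
          holomorphic_on_eval_fps[OF unit_disc_subset_eball[OF B]], unfolded o_def]) auto
  have F_holo: "F holomorphic_on upper_half_plane"
    unfolding F_def by (intro holomorphic_intros B_holo)
  have S_holo: "(\<lambda>z. F (- 1 / z)) holomorphic_on upper_half_plane"
  proof -
    have "(\<lambda>z. - 1 / z) holomorphic_on upper_half_plane"
      by (intro holomorphic_intros) (auto simp: upper_half_plane_def)
    from holomorphic_on_compose_gen[OF this F_holo] show ?thesis
      using inv_uhp by (auto simp: o_def)
  qed
  have tail: "(LINT t:{y..}|lborel. of_real ((t - y) ^ w) * f (\<i> * of_real t)) = K * F (\<i> * of_real y)"
    if "y > 0" for y
    unfolding K_def F_def B_def by (rule eichler_integral[OF A fA that])
  have "F (- 1 / z) * z ^ (2 * v) = F z" if z: "z \<in> upper_half_plane" for z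
  proof -
    \<comment> \<open>Identity theorem: the difference is holomorphic on the connected half plane
      and vanishes on the imaginary axis, which accumulates at i.\<close>
    have "F (- 1 / z) * z ^ w - F z = 0"
    proof (rule analytic_continuation[where f = "\<lambda>z. F (- 1 / z) * z ^ w - F z"
          and U = "(\<lambda>y. \<i> * of_real y) ` {0<..}" and \<xi> = \<i>, OF _ open_uhp conn])
      show "(\<lambda>z. F (- 1 / z) * z ^ w - F z) holomorphic_on upper_half_plane"
        by (intro holomorphic_intros S_holo F_holo)
      show "\<i> \<in> upper_half_plane" by (simp add: upper_half_plane_def)
      show "(\<lambda>y. \<i> * of_real y) ` {0<..} \<subseteq> upper_half_plane"
        by (auto simp: upper_half_plane_def)
      show "z \<in> upper_half_plane" by (rule z)
      show "\<i> islimpt (\<lambda>y. \<i> * of_real y) ` {0<..}"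
        unfolding islimpt_approachable
      proof (intro allI impI)
        fix e :: real assume "e > 0"
        define x' where "x' = \<i> * complex_of_real (1 + e / 2)"
        have mem: "x' \<in> (\<lambda>y. \<i> * complex_of_real y) ` {0<..}"
          unfolding x'_def using \<open>e > 0\<close> by (intro image_eqI[OF refl]) simp
        have "x' - \<i> = \<i> * of_real (e / 2)" by (simp add: x'_def algebra_simps)
        then have "dist x' \<i> = e / 2"
          using \<open>e > 0\<close> by (simp only: dist_norm norm_mult norm_of_real) simp
        then show "\<exists>x'\<in>(\<lambda>y. \<i> * of_real y) ` {0<..}. x' \<noteq> \<i> \<and> dist x' \<i> < e"
          using \<open>e > 0\<close> by (intro bexI[OF _ mem]) auto
      qed
      fix x assume "x \<in> (\<lambda>y. \<i> * of_real y) ` {0<..}"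
      then obtain y where y: "y > 0" "x = \<i> * of_real y" by auto
      have "K * F (\<i> * of_real (1 / y)) * x ^ w = K * F x"
        using tail_integral_inversion[OF f k zero y(1)] y
        unfolding w_def[symmetric] by (simp only: tail zero_less_divide_1_iff)
      then have "F (\<i> * of_real (1 / y)) * x ^ w = F x"
        using \<open>K \<noteq> 0\<close> by simp
      moreover have "- 1 / x = \<i> * of_real (1 / y)" using y by (simp add: field_simps)
      ultimately show "F (- 1 / x) * x ^ w - F x = 0" by simp
    qed
    then show ?thesis by (simp add: v)
  qed
  then have "B = 0"
    unfolding F_def by (rule nonpositive_weight_cusp_form_zero[OF B])
  have "fps_nth A r = 0" for r
    using arg_cong[OF \<open>B = 0\<close>, of "\<lambda>B. fps_nth B r"] by (simp add: B_def eichler_fps_def del: of_nat_Suc)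
  then have "A = 0" by (simp add: fps_eq_iff)
  show ?thesis
  proof
    show "f z = 0" for z
      using fA[of z] f \<open>A = 0\<close> by (cases "z \<in> upper_half_plane") (auto simp: cusp_forms_def)
  qed
qed

section \<open>The period map\<close>

lemma cusp_forms_function_space: "function_space (cusp_forms k)"
  unfolding function_space_def
proof (intro conjI ballI allI)
  show "(\<lambda>_. 0) \<in> cusp_forms k"
    by (auto simp: cusp_forms_def intro!: exI[of _ "\<lambda>_. 0"])
next
  fix u v assume u: "u \<in> cusp_forms k" and v: "v \<in> cusp_forms k"
  obtain a b where "\<forall>z\<in>upper_half_plane. (\<lambda>r. a r * exp (2 * of_real pi * \<i> * z) ^ (r + 1)) sums u z"
    "\<forall>z\<in>upper_half_plane. (\<lambda>r. b r * exp (2 * of_real pi * \<i> * z) ^ (r + 1)) sums v z"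
    using u v unfolding cusp_forms_def by blast
  then have "\<forall>z\<in>upper_half_plane.
      (\<lambda>r. (a r + b r) * exp (2 * of_real pi * \<i> * z) ^ (r + 1)) sums (u z + v z)"
    unfolding distrib_right by (intro ballI sums_add) blast+
  then have "\<exists>a. \<forall>z\<in>upper_half_plane.
      (\<lambda>r. a r * exp (2 * of_real pi * \<i> * z) ^ (r + 1)) sums (u z + v z)"
    by (rule exI[of _ "\<lambda>r. a r + b r"])
  moreover have "(\<lambda>z. u z + v z) holomorphic_on upper_half_plane"
    using u v by (intro holomorphic_intros) (auto simp: cusp_forms_def)
  ultimately show "(\<lambda>z. u z + v z) \<in> cusp_forms k"
    using u v unfolding cusp_forms_def mem_Collect_eq by (simp only: distrib_left) simp
next
  fix c u assume u: "u \<in> cusp_forms k"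
  obtain a where "\<forall>z\<in>upper_half_plane. (\<lambda>r. a r * exp (2 * of_real pi * \<i> * z) ^ (r + 1)) sums u z"
    using u unfolding cusp_forms_def by blast
  then have "\<forall>z\<in>upper_half_plane.
      (\<lambda>r. (c * a r) * exp (2 * of_real pi * \<i> * z) ^ (r + 1)) sums (c * u z)"
    unfolding mult.assoc by (intro ballI sums_mult) blast
  then have "\<exists>a. \<forall>z\<in>upper_half_plane.
      (\<lambda>r. a r * exp (2 * of_real pi * \<i> * z) ^ (r + 1)) sums (c * u z)"
    by (rule exI[of _ "\<lambda>r. c * a r"])
  moreover have "(\<lambda>z. c * u z) holomorphic_on upper_half_plane"
    using u by (intro holomorphic_intros) (auto simp: cusp_forms_def)
  ultimately show "(\<lambda>z. c * u z) \<in> cusp_forms k"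
    using u unfolding cusp_forms_def mem_Collect_eq by (simp only: mult.left_commute) simp
qed

text \<open>Kept in the complex-power form of \<open>mult_Lambda\<close>, so that its integrand is
  literally a product of such factors; for m \<ge> 1 and t > 0 this is the moment of order m -
  1.\<close>

definition period_integrand :: "(complex \<Rightarrow> complex) \<Rightarrow> int \<Rightarrow> real \<Rightarrow> complex" where
  "period_integrand f m t = f (\<i> * of_real t) * of_real t powr (of_int m - 1)"

definition period :: "int \<Rightarrow> (complex \<Rightarrow> complex) \<Rightarrow> complex" where
  "period m f = (LINT t:{0<..}|lborel. period_integrand f m t)"

lemma period_integrand_nat:
  assumes "t > 0"
  shows "period_integrand f (int p + 1) t = of_real (t ^ p) * f (\<i> * of_real t)"
  using assms by (simp add: period_integrand_def powr_nat)

lemma period_integrable: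
  assumes "f \<in> cusp_forms k" "m \<ge> 1"
  shows "set_integrable lborel {0<..} (period_integrand f m)"
proof -
  define p where "p = nat (m - 1)"
  have m: "m = int p + 1" using assms(2) by (simp add: p_def)
  show ?thesis
    using cusp_form_moment_integrable[OF assms(1), of p] unfolding m
    by (rule set_integrable_cong[THEN iffD1, rotated 3]) (auto simp: period_integrand_nat)
qed

lemma period_integrand_add: "period_integrand (\<lambda>z. u z + v z) m t = period_integrand u m t + period_integrand v m t"
  by (simp add: period_integrand_def distrib_right)

lemma period_integrand_scale: "period_integrand (\<lambda>z. c * u z) m t = c * period_integrand u m t"
  by (simp add: period_integrand_def)

lemma period_linear:
  assumes "m \<ge> 1"
  shows "linear_functional (cusp_forms k) (period m)"
  unfolding linear_functional_def period_def period_integrand_add period_integrand_scale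
  using period_integrable assms by (auto intro!: set_integral_add)

lemma periods_separate:
  assumes f: "f \<in> cusp_forms k" and k: "even k" "k > 0"
    and zero: "\<And>m. m \<in> {1..int k - 1} \<Longrightarrow> period m f = 0"
  shows "f = (\<lambda>_. 0)"
proof (rule cusp_form_moments_separate[OF f k])
  fix p assume "p \<le> k - 2"
  \<comment> \<open>Evenness excludes k = 1, so \<open>k - 2\<close> is not truncated and p + 1 is
    at most k - 1.\<close>
  moreover have "k \<ge> 2" using k by (auto elim: evenE)
  ultimately have "period (int p + 1) f = 0" by (intro zero) auto
  moreover have "period (int p + 1) f = (LINT t:{0<..}|lborel. of_real (t ^ p) * f (\<i> * of_real t))"
    unfolding period_def by (intro set_lebesgue_integral_cong) (auto simp: period_integrand_nat)
  ultimately show "(LINT t:{0<..}|lborel. of_real (t ^ p) * f (\<i> * of_real t)) = 0" by simp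
qed

section \<open>Multiple L-values as multilinear functionals\<close>

lemma mult_Lambda_perm_integrand:
  "mult_Lambda_perm n \<sigma> f (\<lambda>j. of_int (m j)) =
    (LINT t : positive_simplex n | PiM {1..n} (\<lambda>_. lborel).
      \<Prod>j=1..n. period_integrand (f (\<sigma> j)) (m (\<sigma> j)) (t j))"
  by (simp add: mult_Lambda_perm_def mult_Lambda_def period_integrand_def positive_simplex_def)

text \<open>The form in slot j enters a single factor, at the position that \<open>\<sigma>\<close>
  sends to j. The integrand is therefore linear in it, and integrability over the simplex passes
  additivity to the integral.\<close>

lemma mult_Lambda_perm_multilinear:
  assumes \<sigma>: "\<sigma> permutes {1..n}" and m: "\<And>j. j \<in> {1..n} \<Longrightarrow> m j \<ge> 1"
  shows "multilinear_on {1..n} (\<lambda>j. cusp_forms (k j)) (\<lambda>f. mult_Lambda_perm n \<sigma> f (\<lambda>j. of_int (m j)))"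
  unfolding multilinear_on_def
proof (intro ballI)
  fix f j assume f: "f \<in> PiE {1..n} (\<lambda>j. cusp_forms (k j))" and j: "j \<in> {1..n}"
  define g where "g u t = (\<Prod>i=1..n. period_integrand ((f(j := u)) (\<sigma> i)) (m (\<sigma> i)) (t i))" for u t
  obtain i0 where i0: "i0 \<in> {1..n}" "\<sigma> i0 = j"
    using permutes_image[OF \<sigma>] j by (metis imageE)
  have \<sigma>_neq: "\<sigma> i \<noteq> j" if "i \<noteq> i0" for i
    using that i0(2) permutes_inj[OF \<sigma>] by (auto dest: injD)
  define R where "R t = (\<Prod>i\<in>{1..n} - {i0}. period_integrand (f (\<sigma> i)) (m (\<sigma> i)) (t i))" for t
  have g: "g u t = period_integrand u (m j) (t i0) * R t" for u t
  proof -
    have "g u t = period_integrand ((f(j := u)) (\<sigma> i0)) (m (\<sigma> i0)) (t i0) *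
      (\<Prod>i\<in>{1..n} - {i0}. period_integrand ((f(j := u)) (\<sigma> i)) (m (\<sigma> i)) (t i))"
      unfolding g_def using i0 by (intro prod.remove) auto
    also have "(\<Prod>i\<in>{1..n} - {i0}. period_integrand ((f(j := u)) (\<sigma> i)) (m (\<sigma> i)) (t i)) = R t"
      unfolding R_def using \<sigma>_neq by (intro prod.cong) auto
    finally show ?thesis using i0 by simp
  qed
  have int: "set_integrable (PiM {1..n} (\<lambda>_. lborel)) (positive_simplex n) (g u)"
    if u: "u \<in> cusp_forms (k j)" for u
    unfolding g_def
  proof (rule positive_simplex_set_integrable)
    fix i assume "i \<in> {1..n}"
    then have i: "\<sigma> i \<in> {1..n}" using permutes_in_image[OF \<sigma>] by blast
    then have "(f(j := u)) (\<sigma> i) \<in> cusp_forms (k (\<sigma> i))"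
      using f u by (auto simp: PiE_iff)
    then show "set_integrable lborel {0<..} (period_integrand ((f(j := u)) (\<sigma> i)) (m (\<sigma> i)))"
      using m[OF i] by (rule period_integrable)
  qed
  have Lambda: "mult_Lambda_perm n \<sigma> (f(j := u)) (\<lambda>j. of_int (m j)) =
      (LINT t : positive_simplex n | PiM {1..n} (\<lambda>_. lborel). g u t)" for u
    unfolding mult_Lambda_perm_integrand g_def ..
  show "linear_functional (cusp_forms (k j)) (\<lambda>u. mult_Lambda_perm n \<sigma> (f(j := u)) (\<lambda>j. of_int (m j)))"
    unfolding linear_functional_def Lambda
  proof (intro conjI ballI allI)
    fix u v assume uv: "u \<in> cusp_forms (k j)" "v \<in> cusp_forms (k j)"
    have "g (\<lambda>z. u z + v z) t = g u t + g v t" for t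
      unfolding g period_integrand_add by (rule distrib_right)
    then show "(LINT t : positive_simplex n | PiM {1..n} (\<lambda>_. lborel). g (\<lambda>z. u z + v z) t) =
        (LINT t : positive_simplex n | PiM {1..n} (\<lambda>_. lborel). g u t) +
        (LINT t : positive_simplex n | PiM {1..n} (\<lambda>_. lborel). g v t)"
      using set_integral_add(2)[OF int[OF uv(1)] int[OF uv(2)]] by simp
  next
    fix c u
    have "g (\<lambda>z. c * u z) t = c * g u t" for t
      unfolding g period_integrand_scale by (rule mult.assoc)
    then show "(LINT t : positive_simplex n | PiM {1..n} (\<lambda>_. lborel). g (\<lambda>z. c * u z) t) =
        c * (LINT t : positive_simplex n | PiM {1..n} (\<lambda>_. lborel). g u t)"
      by simp
  qed
qed

text \<open>The one relation among multiple L-values on which injectivity rests: it recovers a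
  product of one-variable periods from the coordinates of the period map.\<close>

lemma sum_mult_Lambda_perm:
  assumes "f \<in> PiE {1..n} (\<lambda>j. cusp_forms (k j))" "m \<in> PiE {1..n} (\<lambda>j. {1..int (k j) - 1})"
  shows "(\<Sum>\<sigma> | \<sigma> permutes {1..n}. mult_Lambda_perm n \<sigma> f (\<lambda>j. of_int (m j))) =
    (\<Prod>j=1..n. period (m j) (f j))"
  unfolding mult_Lambda_perm_integrand period_def
proof (rule sum_permuted_simplex_integrals)
  fix j assume "j \<in> {1..n}"
  then have "f j \<in> cusp_forms (k j)" "m j \<ge> 1" using assms by (auto simp: PiE_iff)
  then show "set_integrable lborel {0<..} (period_integrand (f j) (m j))"
    by (rule period_integrable)
qed

lemma period_map_exists: "\<exists>L. is_period_map n k L"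
proof -
  \<comment> \<open>The value 0 off the index set is the one \<open>is_period_map\<close>
    prescribes, and it is trivially multilinear.\<close>
  define \<Lambda> where "\<Lambda> = (\<lambda>p f. if p \<in> period_index n k
    then mult_Lambda_perm n (fst p) f (\<lambda>j. of_int (snd p j)) else 0)"
  have "multilinear_on {1..n} (\<lambda>j. cusp_forms (k j)) (\<Lambda> p)" for p
  proof (cases "p \<in> period_index n k")
    case True
    then have "fst p permutes {1..n}" "\<And>j. j \<in> {1..n} \<Longrightarrow> snd p j \<ge> 1"
      by (auto simp: period_index_def PiE_iff)
    from mult_Lambda_perm_multilinear[of "fst p" n "snd p" k, OF this] True show ?thesis by (simp add: \<Lambda>_def)
  next
    case False
    then show ?thesis by (simp add: \<Lambda>_def multilinear_on_def linear_functional_def)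
  qed
  then obtain L where L: "tensor_linear {1..n} (\<lambda>j. cusp_forms (k j)) L"
    and L_class: "\<And>x p. x \<in> free_space {1..n} (\<lambda>j. cusp_forms (k j)) \<Longrightarrow>
      L (tensor_class {1..n} (\<lambda>j. cusp_forms (k j)) x) p = free_extend (\<Lambda> p) x"
    using tensor_lift_exists by blast
  have "is_period_map n k L"
    unfolding is_period_map_def
  proof (intro conjI ballI allI impI)
    fix X p assume "X \<in> cusp_tensor n k" "p \<notin> period_index n k"
    then show "L X p = 0"
      unfolding tensor_product_def by (auto simp: L_class free_extend_def \<Lambda>_def simp del: One_nat_def)
  next
    fix f p assume f: "f \<in> PiE {1..n} (\<lambda>j. cusp_forms (k j))" and p: "p \<in> period_index n k"
    then show "case p of (\<sigma>, m) \<Rightarrow> L (pure_tensor {1..n} (\<lambda>j. cusp_forms (k j)) f) (\<sigma>, m) =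
        mult_Lambda_perm n \<sigma> f (\<lambda>j. of_int (m j))"
      unfolding pure_tensor_def
      by (cases p) (simp add: L_class[OF free_space_basis[OF f]] \<Lambda>_def del: One_nat_def)
  qed (rule L)
  then show ?thesis by blast
qed

text \<open>If two classes have the same image, every multiple L-value functional vanishes on the
  difference of representatives. Summing over \<open>\<sigma>\<close> gives the same for all
  products of periods, which separate the tensor product.\<close>

lemma period_map_inj_on:
  assumes k: "\<And>j. j \<in> {1..n} \<Longrightarrow> even (k j) \<and> k j > 0" and L: "is_period_map n k L"
  shows "inj_on L (cusp_tensor n k)"
proof (rule inj_onI)
  let ?I = "{1..n}" and ?V = "\<lambda>j. cusp_forms (k j)" and ?M = "\<lambda>j. {1..int (k j) - 1}"
  fix X Y assume "X \<in> cusp_tensor n k" "Y \<in> cusp_tensor n k" and eq: "L X = L Y"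
  then obtain x y where x: "x \<in> free_space ?I ?V" "X = tensor_class ?I ?V x"
    and y: "y \<in> free_space ?I ?V" "Y = tensor_class ?I ?V y"
    unfolding tensor_product_def by blast
  have lin: "tensor_linear ?I ?V L" using L by (simp add: is_period_map_def)
  have xy: "x - y \<in> free_space ?I ?V" using x(1) y(1) by (rule free_space_diff)
  have "x - y \<in> tensor_relations ?I ?V"
  proof (rule tensor_relations_separation[where M = ?M and l = "\<lambda>j. period"])
    fix \<mu> assume \<mu>: "\<mu> \<in> PiE ?I ?M"
    have "free_extend (\<lambda>f. mult_Lambda_perm n \<sigma> f (\<lambda>j. of_int (\<mu> j))) (x - y) = 0"
      if \<sigma>: "\<sigma> \<in> {\<sigma>. \<sigma> permutes ?I}" for \<sigma>
    proof -
      have p: "(\<sigma>, \<mu>) \<in> period_index n k" using \<sigma> \<mu> by (simp add: period_index_def)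
      have "free_extend (\<lambda>f. mult_Lambda_perm n \<sigma> f (\<lambda>j. of_int (\<mu> j))) (x - y) =
          free_extend (\<lambda>f. L (pure_tensor ?I ?V f) (\<sigma>, \<mu>)) (x - y)"
      proof (rule free_extend_cong)
        fix f assume "f \<in> Poly_Mapping.keys (x - y)"
        then have "f \<in> PiE ?I ?V" using xy by (auto simp: free_space_def)
        then show "mult_Lambda_perm n \<sigma> f (\<lambda>j. of_int (\<mu> j)) = L (pure_tensor ?I ?V f) (\<sigma>, \<mu>)"
          using L p unfolding is_period_map_def by fastforce
      qed
      also have "\<dots> = L X (\<sigma>, \<mu>) - L Y (\<sigma>, \<mu>)"
        unfolding free_extend_diff x(2) y(2) tensor_linear_class[OF lin x(1)]
          tensor_linear_class[OF lin y(1)] ..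
      finally show ?thesis using eq by simp
    qed
    then have "free_extend (\<lambda>f. \<Sum>\<sigma> | \<sigma> permutes ?I. mult_Lambda_perm n \<sigma> f (\<lambda>j. of_int (\<mu> j))) (x - y) = 0"
      unfolding free_extend_sum by (intro sum.neutral) blast
    also have "free_extend (\<lambda>f. \<Sum>\<sigma> | \<sigma> permutes ?I. mult_Lambda_perm n \<sigma> f (\<lambda>j. of_int (\<mu> j))) (x - y) =
        free_extend (\<lambda>f. \<Prod>j\<in>?I. period (\<mu> j) (f j)) (x - y)"
    proof (rule free_extend_cong)
      fix f assume "f \<in> Poly_Mapping.keys (x - y)"
      then have "f \<in> PiE ?I ?V" using xy by (auto simp: free_space_def)
      then show "(\<Sum>\<sigma> | \<sigma> permutes ?I. mult_Lambda_perm n \<sigma> f (\<lambda>j. of_int (\<mu> j))) =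
          (\<Prod>j\<in>?I. period (\<mu> j) (f j))"
        using \<mu> by (rule sum_mult_Lambda_perm)
    qed
    finally show "free_extend (\<lambda>f. \<Prod>j\<in>?I. period (\<mu> j) (f j)) (x - y) = 0" .
  next
    show "u = (\<lambda>_. 0)" if "j \<in> ?I" "u \<in> ?V j" "\<And>m. m \<in> ?M j \<Longrightarrow> period m u = 0" for j u
      using that k[of j] by (intro periods_separate[of u "k j"]) auto
  qed (use xy cusp_forms_function_space period_linear in auto)
  then show "X = Y" using x y tensor_class_cong by blast
qed

text \<open>Existence expresses that the map is well defined on the tensor product; it also keeps
  the statement about all period maps from being vacuous.\<close>

theorem proposition0p2:
  fixes n :: nat and k :: "nat \<Rightarrow> nat"
  assumes "n \<ge> 1"
    and "\<And>j. j \<in> {1..n} \<Longrightarrow> even (k j) \<and> k j > 0"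
  shows "(\<exists>L. is_period_map n k L) \<and>
         (\<forall>L. is_period_map n k L \<longrightarrow> inj_on L (cusp_tensor n k))"
  using period_map_exists[of n k] period_map_inj_on[of n k, OF assms(2)] by blast

end
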